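(* Let $p>1$, let $G=(\mathbb{V},\mathbb{E})$ be an infinite, connected, undirected, uniformly locally finite graph, and let $V:\mathbb{V}\to\mathbb{R}$ satisfy $\inf_{x\in\mathbb{V}}V(x)>-1$. If $\lim_{d(x,x_0)\to\infty}V(x)=+\infty$ for some $x_0\in\mathbb{V}$, then the equation $$-\Delta_pu(x)+V(x)|u|^{p-2}u=|u|^{p-2}u\log|u|^p,\quad x\in\mathbb{V},$$ has infinitely many solutions $\pm u_n$ ($n\in\mathbb{N}$) such that $\lim_{n\to\infty}J(\pm u_n)=\infty$.
   Context: All functions are real valued. $x\sim y$ means $xy\in\mathbb{E}$; $d$ is the graph distance. Uniformly locally finite means there is a constant $C$ with $\#\{y:y\sim x\}\le C$ for all $x$. $\mu$ is the counting measure and $\int_{\mathbb{V}}f\,d\mu=\sum_{x\in\mathbb{V}}f(x)$. The graph $p$-Laplacian is $\Delta_pu(x)=\sum_{y\sim x}|u(y)-u(x)|^{p-2}(u(y)-u(x))$ (with $|t|^{p-2}t=0$ at $t=0$), and $|\nabla u(x)|_p=\left(\frac12\sum_{y\sim x}|u(y)-u(x)|^p\right)^{1/p}$. $W^{1,p}(\mathbb{V})$ is the completion of the finitely supported functions under $\left(\int_{\mathbb{V}}(|\nabla u|_p^p+|u|^p)d\mu\right)^{1/p}$, and $X=\{u\in W^{1,p}(\mathbb{V}):\int_{\mathbb{V}}(|\nabla u|_p^p+(V(x)+1)|u|^p)\,d\mu<\infty\}$. The energy $J:X\to(-\infty,+\infty]$ is $$J(u)=\frac1p\int_{\mathbb{V}}\left(|\nabla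 u|_p^p+(V(x)+1)|u|^p\right)d\mu-\frac1p\int_{\mathbb{V}}|u|^p\log|u|^p\,d\mu,$$ with $0\log0=0$. A solution is $u\in X$ with $J(u)<+\infty$ satisfying the equation at every $x\in\mathbb{V}$ (with $|u|^{p-2}u\log|u|^p=0$ where $u=0$). *)

theory Defs
  imports "HOL-Analysis.Analysis"
begin

text \<open>
  A graph is given by its adjacency relation on the vertex type \<open>'a\<close>: \<open>E x y\<close> means that
  \<open>xy\<close> is an edge.
\<close>

definition graph_connected :: "('a \<Rightarrow> 'a \<Rightarrow> bool) \<Rightarrow> bool" where
  "graph_connected E \<longleftrightarrow> (\<forall>x y. E\<^sup>*\<^sup>* x y)"

definition uniformly_locally_finite :: "('a \<Rightarrow> 'a \<Rightarrow> bool) \<Rightarrow> bool" where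
  "uniformly_locally_finite E \<longleftrightarrow>
     (\<exists>C::nat. \<forall>x. finite {y. E y x} \<and> card {y. E y x} \<le> C)"

text \<open>Length of a shortest walk; only meaningful if \<open>x\<close> and \<open>y\<close> are connected by a walk.\<close>

definition graph_dist :: "('a \<Rightarrow> 'a \<Rightarrow> bool) \<Rightarrow> 'a \<Rightarrow> 'a \<Rightarrow> nat" where
  "graph_dist E x y = (LEAST n. (E ^^ n) x y)"

text \<open>
  The convention that \<open>\<bar>t\<bar> powr (p - 2) * t\<close> is \<open>0\<close> at \<open>t = 0\<close> holds automatically.
\<close>

definition p_laplacian :: "('a \<Rightarrow> 'a \<Rightarrow> bool) \<Rightarrow> real \<Rightarrow> ('a \<Rightarrow> real) \<Rightarrow> 'a \<Rightarrow> real" where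
  "p_laplacian E p u x = (\<Sum>y | E y x. \<bar>u y - u x\<bar> powr (p - 2) * (u y - u x))"

definition p_grad :: "('a \<Rightarrow> 'a \<Rightarrow> bool) \<Rightarrow> real \<Rightarrow> ('a \<Rightarrow> real) \<Rightarrow> 'a \<Rightarrow> real" where
  "p_grad E p u x = ((1/2) * (\<Sum>y | E y x. \<bar>u y - u x\<bar> powr p)) powr (1/p)"

text \<open>The \<open>p\<close>-th power of the \<open>W\<^sup>1\<^sup>,\<^sup>p\<close> norm, with value \<open>\<infinity>\<close> allowed.\<close>

definition W1p_norm_pow :: "('a \<Rightarrow> 'a \<Rightarrow> bool) \<Rightarrow> real \<Rightarrow> ('a \<Rightarrow> real) \<Rightarrow> ennreal" where
  "W1p_norm_pow E p u =
     (\<integral>\<^sup>+x. ennreal (p_grad E p u x powr p + \<bar>u x\<bar> powr p) \<partial>count_space UNIV)"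

text \<open>
  The completion of the finitely supported functions, realised as a space of functions: since
  the norm dominates the \<open>\<ell>\<^sup>p\<close> norm, the functions of finite norm form a Banach space, and the
  completion is the closure of the finitely supported functions in it. Convergence to \<open>0\<close> of
  the norm and of its \<open>p\<close>-th power are the same. Finiteness of the norm of \<open>u\<close> follows from
  the existence of the approximating sequence.
\<close>

definition W1p :: "('a \<Rightarrow> 'a \<Rightarrow> bool) \<Rightarrow> real \<Rightarrow> ('a \<Rightarrow> real) set" where
  "W1p E p = {u. \<exists>f :: nat \<Rightarrow> 'a \<Rightarrow> real. (\<forall>n. finite {x. f n x \<noteq> 0}) \<and>
     (\<lambda>n. W1p_norm_pow E p (\<lambda>x. u x - f n x)) \<longlonglongrightarrow> 0}"

text \<open>\<open>ennreal\<close> cuts off negative reals; the integrand is nonnegative since \<open>V > -1\<close>.\<close>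

definition X_energy ::
  "('a \<Rightarrow> 'a \<Rightarrow> bool) \<Rightarrow> real \<Rightarrow> ('a \<Rightarrow> real) \<Rightarrow> ('a \<Rightarrow> real) \<Rightarrow> ennreal" where
  "X_energy E p V u =
     (\<integral>\<^sup>+x. ennreal (p_grad E p u x powr p + (V x + 1) * \<bar>u x\<bar> powr p) \<partial>count_space UNIV)"

definition X_space ::
  "('a \<Rightarrow> 'a \<Rightarrow> bool) \<Rightarrow> real \<Rightarrow> ('a \<Rightarrow> real) \<Rightarrow> ('a \<Rightarrow> real) set" where
  "X_space E p V = {u \<in> W1p E p. X_energy E p V u < \<infinity>}"

text \<open>
  The Lebesgue integral with respect to the counting measure as an extended real number; it is
  meaningful if the positive or the negative part has a finite integral.
\<close>

definition ext_integral :: "('a \<Rightarrow> real) \<Rightarrow> ereal" where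
  "ext_integral f =
     enn2ereal (\<integral>\<^sup>+x. ennreal (f x) \<partial>count_space UNIV)
     - enn2ereal (\<integral>\<^sup>+x. ennreal (- f x) \<partial>count_space UNIV)"

text \<open>
  On the space \<open>X_space\<close> the first term is finite, and so is the integral of the positive part of
  the logarithmic term (as \<open>u\<close> is \<open>p\<close>-summable, \<open>\<bar>u x\<bar> > 1\<close> holds for only finitely many \<open>x\<close>),
  so \<open>\<infinity> - \<infinity>\<close> does not occur and \<open>J > -\<infinity>\<close>. The convention \<open>0 log 0 = 0\<close> holds automatically.
\<close>

definition J ::
  "('a \<Rightarrow> 'a \<Rightarrow> bool) \<Rightarrow> real \<Rightarrow> ('a \<Rightarrow> real) \<Rightarrow> ('a \<Rightarrow> real) \<Rightarrow> ereal" where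
  "J E p V u =
     ereal (1/p) * enn2ereal (X_energy E p V u)
     - ereal (1/p) * ext_integral (\<lambda>x. \<bar>u x\<bar> powr p * ln (\<bar>u x\<bar> powr p))"

definition is_solution ::
  "('a \<Rightarrow> 'a \<Rightarrow> bool) \<Rightarrow> real \<Rightarrow> ('a \<Rightarrow> real) \<Rightarrow> ('a \<Rightarrow> real) \<Rightarrow> bool" where
  "is_solution E p V u \<longleftrightarrow> u \<in> X_space E p V \<and> J E p V u < \<infinity> \<and>
     (\<forall>x. - p_laplacian E p u x + V x * (\<bar>u x\<bar> powr (p - 2) * u x)
          = \<bar>u x\<bar> powr (p - 2) * u x * ln (\<bar>u x\<bar> powr p))"

end

theory Submission
  imports Defs
begin

text \<open>
Multiplying \<open>u\<close> by \<open>t > 0\<close> changes the logarithmic nonlinearity only by the multiple \<open>ln (t powr p)\<close> of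
\<open>\<bar>u\<bar> powr p\<close>. Write \<open>n u\<close> for the sum of \<open>\<bar>u x\<bar> powr p\<close>, and \<open>\<Phi> u\<close> for the Dirichlet energy plus
the sum of \<open>V x * \<bar>u x\<bar> powr p\<close> minus the sum of \<open>\<bar>u x\<bar> powr p * ln (\<bar>u x\<bar> powr p)\<close>. Then
\<open>F u = \<Phi> u / n u + ln (n u)\<close> (called \<open>level\<close> below) is constant on rays, and a critical point of
\<open>F\<close> becomes, after rescaling by the right factor, a solution \<open>v\<close> with \<open>n v = exp (F u)\<close>. On the
other hand the Green identity gives \<open>J v = n v / p\<close> for every solution. So the theorem asks for
critical points of the even function \<open>F\<close> at arbitrarily high levels.

These come from a minimax over odd maps. As \<open>V\<close> tends to infinity, \<open>F \<ge> a\<close> on all functions that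
vanish at \<open>k\<close> suitable vertices (\<open>level_lower\<close>), whereas \<open>F \<le> b\<close> on the functions supported on
these vertices and one more (\<open>level_upper\<close>). By the Borsuk--Ulam theorem every odd
\<open>k\<close>-dimensional sphere contains a function vanishing at the \<open>k\<close> vertices, so the
infimum over such spheres of the maximum of \<open>F\<close> lies in \<open>[a, b]\<close>, and a gradient step
shows that it is a critical value (\<open>even_minimax\<close>). This is carried out for functions supported on
the first \<open>N\<close> vertices only, where everything is finite-dimensional. The bounds \<open>a\<close>, \<open>b\<close> do not
depend on \<open>N\<close>, and growth of \<open>V\<close> prevents mass from escaping, so the finite Dirichlet solutions
converge along a subsequence to a solution on the whole graph (\<open>unbounded_solutions_on_nat\<close>).

The Borsuk--Ulam theorem is derived from Tucker's combinatorial lemma, which is proved by the parity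
argument of Freund and Todd (\<open>tucker_grid\<close>).
\<close>

section \<open>Tucker's lemma on a grid\<close>

lemma even_card_involution:
  assumes "finite A" and "\<And>x. x \<in> A \<Longrightarrow> f x \<in> A" and "\<And>x. x \<in> A \<Longrightarrow> f (f x) = x"
    and "\<And>x. x \<in> A \<Longrightarrow> f x \<noteq> x"
  shows "even (card A)"
  using assms
proof (induction "card A" arbitrary: A rule: less_induct)
  case less
  show ?case
  proof (cases "A = {}")
    case False
    then obtain x where x: "x \<in> A" by blast
    define B where "B = A - {x, f x}"
    have fx: "f x \<in> A" "f x \<noteq> x" using less.prems x by auto
    have cB: "card A = card B + 2"
    proof -
      have "card {x, f x} = 2" using fx by auto
      moreover have "card A = card B + card {x, f x}"
        unfolding B_def using x fx less.prems(1)
        by (metis bot.extremum card_Diff_subset card_mono finite.emptyI finite.insertI insert_subset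
            le_add_diff_inverse2)
      ultimately show ?thesis by simp
    qed
    have "even (card B)"
    proof (rule less.hyps)
      show "card B < card A" using cB by simp
      show "finite B" using less.prems B_def by simp
      fix y assume y: "y \<in> B"
      hence yA: "y \<in> A" "y \<noteq> x" "y \<noteq> f x" by (auto simp: B_def)
      show "f y \<in> B"
        using yA less.prems(2,3) x unfolding B_def by (metis Diff_iff empty_iff insert_iff)
      show "f (f y) = y" "f y \<noteq> y" using yA less.prems by auto
    qed
    thus ?thesis using cB by simp
  qed simp
qed

text \<open>
Each orthant of the cube \<open>[-m, m]\<close> to the power \<open>n\<close>, and each face of an orthant, carries the
Freudenthal triangulation. A sign vector \<open>s\<close> with support \<open>set \<pi>\<close> selects the orthant; in terms of
absolute values, a simplex starts at \<open>z\<close> and increases the coordinates one at a time in the order of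
the list \<open>\<pi>\<close>. Taking absolute values first makes the triangulations of neighbouring orthants agree
on common faces, and makes the whole triangulation invariant under \<open>x \<mapsto> - x\<close>.
\<close>

definition abs_vertex :: "(nat \<Rightarrow> int) \<Rightarrow> nat list \<Rightarrow> nat \<Rightarrow> nat \<Rightarrow> int" where
  "abs_vertex z \<pi> i = (\<lambda>j. z j + of_bool (j \<in> set (take i \<pi>)))"

definition vertex :: "(nat \<Rightarrow> int) \<Rightarrow> (nat \<Rightarrow> int) \<Rightarrow> nat list \<Rightarrow> nat \<Rightarrow> nat \<Rightarrow> int" where
  "vertex s z \<pi> i = (\<lambda>j. s j * abs_vertex z \<pi> i j)"

definition cell :: "nat \<Rightarrow> int \<Rightarrow> (nat \<Rightarrow> int) \<Rightarrow> (nat \<Rightarrow> int) \<Rightarrow> nat list \<Rightarrow> bool" where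
  "cell n m s z \<pi> \<longleftrightarrow> distinct \<pi> \<and> set \<pi> \<subseteq> {..<n} \<and>
     (\<forall>j\<in>set \<pi>. (s j = - 1 \<or> s j = 1) \<and> 0 \<le> z j \<and> z j < m) \<and>
     (\<forall>j. j \<notin> set \<pi> \<longrightarrow> s j = 0 \<and> z j = 0)"

definition grid :: "nat \<Rightarrow> int \<Rightarrow> (nat \<Rightarrow> int) set" where
  "grid n m = {x. (\<forall>j<n. \<bar>x j\<bar> \<le> m) \<and> (\<forall>j\<ge>n. x j = 0)}"

definition orthant_labels :: "(nat \<Rightarrow> int) \<Rightarrow> nat list \<Rightarrow> (nat \<times> int) set" where
  "orthant_labels s \<pi> = (\<lambda>j. (j, s j)) ` set \<pi>"

text \<open>
A door is a simplex of full dimension in its orthant face, together with the index \<open>i\<close> of a vertex such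
that the facet opposite to that vertex carries exactly the labels \<open>(j, s j)\<close> prescribed by the signs
of the orthant. The origin, with the empty list, is a door of dimension zero.
\<close>

definition doors ::
  "nat \<Rightarrow> int \<Rightarrow> ((nat \<Rightarrow> int) \<Rightarrow> nat \<times> int) \<Rightarrow> ((nat \<Rightarrow> int) \<times> (nat \<Rightarrow> int) \<times> nat list \<times> nat) set" where
  "doors n m l = {(s, z, \<pi>, i). cell n m s z \<pi> \<and> i \<le> length \<pi> \<and>
     (\<lambda>i'. l (vertex s z \<pi> i')) ` ({..length \<pi>} - {i}) = orthant_labels s \<pi>}"

lemma finite_cells: "finite {(s, z, \<pi>). cell n m s z \<pi>}"
proof -
  let ?S = "{f. \<forall>j. (j \<in> {..<n} \<longrightarrow> f j \<in> {-1..1::int}) \<and> (j \<notin> {..<n} \<longrightarrow> f j = 0)}"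
  let ?Z = "{f. \<forall>j. (j \<in> {..<n} \<longrightarrow> f j \<in> {0..m}) \<and> (j \<notin> {..<n} \<longrightarrow> f j = 0)}"
  let ?P = "{\<pi>. set \<pi> \<subseteq> {..<n} \<and> length \<pi> \<le> n}"
  have fin: "finite (?S \<times> (?Z \<union> {\<lambda>_. 0}) \<times> ?P)"
    by (intro finite_cartesian_product finite_UnI finite_set_of_finite_funs finite_lists_length_le) auto
  have "{(s, z, \<pi>). cell n m s z \<pi>} \<subseteq> ?S \<times> (?Z \<union> {\<lambda>_. 0}) \<times> ?P"
  proof
    fix t assume "t \<in> {(s, z, \<pi>). cell n m s z \<pi>}"
    then obtain s z \<pi> where t: "t = (s, z, \<pi>)" and c: "cell n m s z \<pi>" by auto
    have d: "distinct \<pi>" and sub: "set \<pi> \<subseteq> {..<n}" using c by (auto simp: cell_def)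
    have pj: "if j \<in> set \<pi> then (s j = - 1 \<or> s j = 1) \<and> 0 \<le> z j \<and> z j < m else s j = 0 \<and> z j = 0" for j
      using c by (auto simp: cell_def)
    have "length \<pi> \<le> n"
      using d sub by (metis card_lessThan card_mono distinct_card finite_lessThan)
    moreover have "s \<in> ?S"
    proof (intro CollectI allI conjI impI)
      fix j show "s j \<in> {-1..1}" using pj[of j] by (auto split: if_splits)
      assume "j \<notin> {..<n}" thus "s j = 0" using pj[of j] sub by (auto split: if_splits)
    qed
    moreover have "z \<in> ?Z \<union> {\<lambda>_. 0}"
    proof (cases "\<pi> = []")
      case True thus ?thesis using pj by auto
    next
      case False
      then obtain a where "a \<in> set \<pi>" by (meson hd_in_set)
      hence m: "0 < m" using pj[of a] by auto
      have "z \<in> ?Z"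
      proof (intro CollectI allI conjI impI)
        fix j show "z j \<in> {0..m}" using pj[of j] m by (auto split: if_splits)
        assume "j \<notin> {..<n}" thus "z j = 0" using pj[of j] sub by (auto split: if_splits)
      qed
      thus ?thesis by blast
    qed
    ultimately show "t \<in> ?S \<times> (?Z \<union> {\<lambda>_. 0}) \<times> ?P" using sub unfolding t by blast
  qed
  thus ?thesis using fin finite_subset by blast
qed

lemma finite_doors: "finite (doors n m l)"
proof -
  have "doors n m l \<subseteq> (\<lambda>((s,z,\<pi>),i). (s,z,\<pi>,i)) ` ({(s, z, \<pi>). cell n m s z \<pi>} \<times> {..n})"
  proof (clarify)
    fix s z \<pi> i assume a: "(s, z, \<pi>, i) \<in> doors n m l"
    hence c: "cell n m s z \<pi>" "i \<le> length \<pi>" by (auto simp: doors_def)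
    hence "length \<pi> \<le> n" unfolding cell_def
      by (metis card_lessThan card_mono distinct_card finite_lessThan)
    thus "(s, z, \<pi>, i) \<in> (\<lambda>((s,z,\<pi>),i). (s,z,\<pi>,i)) ` ({(s, z, \<pi>). cell n m s z \<pi>} \<times> {..n})"
      using c by (intro image_eqI[of _ _ "((s,z,\<pi>),i)"]) auto
  qed
  thus ?thesis using finite_cells by (meson finite_SigmaI finite_atMost finite_imageI finite_subset)
qed

lemma vertex_in_grid:
  assumes "cell n m s z \<pi>" "0 \<le> m"
  shows "vertex s z \<pi> i \<in> grid n m"
proof -
  have pj: "if j \<in> set \<pi> then (s j = - 1 \<or> s j = 1) \<and> 0 \<le> z j \<and> z j < m else s j = 0 \<and> z j = 0" for j
    using assms by (auto simp: cell_def)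
  have "\<bar>vertex s z \<pi> i j\<bar> \<le> m" for j
    using pj[of j] assms(2) by (auto simp: vertex_def abs_vertex_def abs_mult split: if_splits)
  moreover have "vertex s z \<pi> i j = 0" if "j \<ge> n" for j
  proof -
    have "j \<notin> set \<pi>" using that assms by (auto simp: cell_def)
    thus ?thesis using pj[of j] by (auto simp: vertex_def)
  qed
  ultimately show ?thesis by (auto simp: grid_def)
qed

lemma vertices_adjacent:
  assumes "cell n m s z \<pi>"
  shows "\<bar>vertex s z \<pi> i j - vertex s z \<pi> i' j\<bar> \<le> 1"
proof -
  have "if j \<in> set \<pi> then (s j = - 1 \<or> s j = 1) \<and> 0 \<le> z j \<and> z j < m else s j = 0 \<and> z j = 0"
    using assms by (auto simp: cell_def)
  thus ?thesis by (auto simp: vertex_def abs_vertex_def of_bool_def algebra_simps split: if_splits)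
qed

lemma card_orthant_labels: "distinct \<pi> \<Longrightarrow> card (orthant_labels s \<pi>) = length \<pi>"
  unfolding orthant_labels_def by (subst card_image) (auto simp: inj_on_def distinct_card)

text \<open>
A facet of a door has as many vertices as it needs labels.
\<close>

lemma doors_inj:
  assumes "(s, z, \<pi>, i) \<in> doors n m l"
  shows "inj_on (\<lambda>i'. l (vertex s z \<pi> i')) ({..length \<pi>} - {i})"
proof (rule eq_card_imp_inj_on)
  show "card ((\<lambda>i'. l (vertex s z \<pi> i')) ` ({..length \<pi>} - {i})) = card ({..length \<pi>} - {i})"
    using assms by (simp add: doors_def card_orthant_labels cell_def)
qed simp

text \<open>
If the vertex opposite to a door also has one of the prescribed labels, then exactly one vertex of the
facet shares this label, and exchanging the two gives the only other door of the same simplex.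
\<close>

lemma parity_same_cell:
  "even (card (doors n m l - {(s, z, \<pi>, i). l (vertex s z \<pi> i) \<notin> orthant_labels s \<pi>}))"
    (is "even (card ?A)")
proof -
  define w where "w = (\<lambda>(s, z, \<pi>, i). THE i'. i' \<le> length \<pi> \<and> i' \<noteq> i \<and>
     l (vertex s z \<pi> i') = l (vertex s z \<pi> i))"
  define f where "f = (\<lambda>(s, z, \<pi>, i). (s, z, \<pi>, w (s, z, \<pi>, i)))"
  have key: "(s, z, \<pi>, i') \<in> ?A \<and> w (s, z, \<pi>, i) = i'"
    if a: "(s, z, \<pi>, i) \<in> ?A" and i': "i' \<le> length \<pi>" "i' \<noteq> i" "l (vertex s z \<pi> i') = l (vertex s z \<pi> i)"
    for s z \<pi> i i'
  proof
    have d: "(s, z, \<pi>, i) \<in> doors n m l" using a by auto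
    have "(\<lambda>k. l (vertex s z \<pi> k)) ` ({..length \<pi>} - {i'}) = (\<lambda>k. l (vertex s z \<pi> k)) ` ({..length \<pi>} - {i})"
    proof -
      have "(\<lambda>k. l (vertex s z \<pi> k)) ` ({..length \<pi>} - {i'}) =
        (\<lambda>k. l (vertex s z \<pi> k)) ` {..length \<pi>}" if "i' \<le> length \<pi>" "i \<le> length \<pi>" "i' \<noteq> i"
          "l (vertex s z \<pi> i') = l (vertex s z \<pi> i)" for i i'
        using that by (auto simp: image_iff) (metis atMost_iff Diff_iff singletonD)
      from this[of i' i] this[of i i'] show ?thesis using i' d by (auto simp: doors_def)
    qed
    thus "(s, z, \<pi>, i') \<in> ?A" using a i' by (auto simp: doors_def)
    show "w (s, z, \<pi>, i) = i'" unfolding w_def prod.case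
    proof (rule the_equality)
      show "i' \<le> length \<pi> \<and> i' \<noteq> i \<and> l (vertex s z \<pi> i') = l (vertex s z \<pi> i)" using i' by simp
      fix k assume "k \<le> length \<pi> \<and> k \<noteq> i \<and> l (vertex s z \<pi> k) = l (vertex s z \<pi> i)"
      thus "k = i'" using inj_onD[OF doors_inj[OF d], of k i'] i' by auto
    qed
  qed
  have ex: "\<exists>i'. i' \<le> length \<pi> \<and> i' \<noteq> i \<and> l (vertex s z \<pi> i') = l (vertex s z \<pi> i)"
    if a: "(s, z, \<pi>, i) \<in> ?A" for s z \<pi> i
  proof -
    have "l (vertex s z \<pi> i) \<in> (\<lambda>i'. l (vertex s z \<pi> i')) ` ({..length \<pi>} - {i})"
      using a by (auto simp: doors_def)
    thus ?thesis by (auto simp: image_iff)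
  qed
  show ?thesis
  proof (rule even_card_involution[where f = f])
    show "finite ?A" using finite_doors by blast
    fix t assume tA: "t \<in> ?A"
    obtain s z \<pi> i where t: "t = (s, z, \<pi>, i)" by (cases t)
    obtain i' where i': "i' \<le> length \<pi>" "i' \<noteq> i" "l (vertex s z \<pi> i') = l (vertex s z \<pi> i)"
      using ex tA t by blast
    have k: "(s, z, \<pi>, i') \<in> ?A" "w (s, z, \<pi>, i) = i'" using key[OF _ i'] tA t by auto
    have "i \<le> length \<pi>" using tA t by (auto simp: doors_def)
    hence k2: "w (s, z, \<pi>, i') = i" using key[OF k(1), of i] i' by auto
    show "f t \<in> ?A" "f (f t) = t" "f t \<noteq> t"
      using k k2 i' t by (auto simp: f_def)
  qed
qed

text \<open>
Inside an orthant face a facet belongs to exactly two simplices, unless it lies on the boundary. In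
terms of \<open>(z, \<pi>)\<close> the other simplex arises by interchanging two consecutive directions if an inner
vertex is replaced, and by rotating \<open>\<pi>\<close> and shifting \<open>z\<close> if the first or the last vertex is replaced.
The excluded doors are the origin and those where this shift would leave the orthant or the cube.
\<close>

lemma parity_pivot:
  "even (card (doors n m l - {(s, z, \<pi>, i). \<pi> = [] \<or> i = length \<pi> \<and> z (last \<pi>) = 0 \<or> i = 0 \<and> z (hd \<pi>) = m - 1}))"
    (is "even (card ?A)")
proof -
  define f :: "(nat \<Rightarrow> int) \<times> (nat \<Rightarrow> int) \<times> nat list \<times> nat \<Rightarrow> _" where
    "f = (\<lambda>(s, z, \<pi>, i).
      if i = 0 then (s, z(hd \<pi> := z (hd \<pi>) + 1), tl \<pi> @ [hd \<pi>], length \<pi>)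
      else if i = length \<pi> then (s, z(last \<pi> := z (last \<pi>) - 1), last \<pi> # butlast \<pi>, 0)
      else (s, z, \<pi>[i - 1 := \<pi> ! i, i := \<pi> ! (i - 1)], i))"
  have "f t \<in> ?A \<and> f (f t) = t \<and> f t \<noteq> t" if tA: "t \<in> ?A" for t
  proof -
    obtain s z \<pi> i where t: "t = (s, z, \<pi>, i)" by (cases t)
    have c: "cell n m s z \<pi>" and il: "i \<le> length \<pi>" and
      lab: "(\<lambda>i'. l (vertex s z \<pi> i')) ` ({..length \<pi>} - {i}) = orthant_labels s \<pi>" and ne: "\<pi> \<noteq> []"
      and last: "i = length \<pi> \<Longrightarrow> z (last \<pi>) \<noteq> 0" and hd: "i = 0 \<Longrightarrow> z (hd \<pi>) \<noteq> m - 1"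
      using tA t by (auto simp: doors_def)
    have dis: "distinct \<pi>" using c by (auto simp: cell_def)
    consider "i = 0" | "i = length \<pi>" "i \<noteq> 0" | "0 < i" "i < length \<pi>" using il by linarith
    thus ?thesis
    proof cases
      case 1
      obtain a \<rho> where pi: "\<pi> = a # \<rho>" using ne by (cases \<pi>) auto
      let ?z = "z(a := z a + 1)"
      have ft: "f t = (s, ?z, \<rho> @ [a], Suc (length \<rho>))" using 1 t pi by (simp add: f_def)
      have c': "cell n m s ?z (\<rho> @ [a])" using c hd 1 pi by (auto simp: cell_def)
      have v: "vertex s ?z (\<rho> @ [a]) k = vertex s z \<pi> (Suc k)" if "k \<le> length \<rho>" for k
        using that dis pi in_set_takeD[of a k \<rho>] by (auto simp: vertex_def abs_vertex_def fun_eq_iff)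
      have "(\<lambda>i'. l (vertex s ?z (\<rho> @ [a]) i')) ` ({..Suc (length \<rho>)} - {Suc (length \<rho>)})
         = (\<lambda>i'. l (vertex s z \<pi> (Suc i'))) ` {..length \<rho>}"
        using v by (intro image_cong) auto
      also have "\<dots> = (\<lambda>i'. l (vertex s z \<pi> i')) ` (Suc ` {..length \<rho>})" by (simp add: image_image)
      also have "Suc ` {..length \<rho>} = {..length \<pi>} - {0}" using pi
        by (simp add: image_Suc_atMost) auto
      also have "(\<lambda>i'. l (vertex s z \<pi> i')) ` ({..length \<pi>} - {0}) = orthant_labels s (\<rho> @ [a])"
        using lab 1 pi by (simp add: orthant_labels_def)
      finally have "(\<lambda>i'. l (vertex s ?z (\<rho> @ [a]) i')) ` ({..Suc (length \<rho>)} - {Suc (length \<rho>)}) =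
        orthant_labels s (\<rho> @ [a])" .
      moreover have "z a \<ge> 0" using c pi by (auto simp: cell_def)
      ultimately have "f t \<in> ?A" using c' unfolding ft by (simp add: doors_def)
      moreover have "f (f t) = t" unfolding ft using t pi 1 by (simp add: f_def butlast_append)
      ultimately show ?thesis using t 1 ft by simp
    next
      case 2
      obtain a \<rho> where pi: "\<pi> = \<rho> @ [a]" using ne by (cases \<pi> rule: rev_cases) auto
      let ?z = "z(a := z a - 1)"
      have ft: "f t = (s, ?z, a # \<rho>, 0)" using 2 t pi by (simp add: f_def)
      have c': "cell n m s ?z (a # \<rho>)" using c last 2 pi by (auto simp: cell_def)
      have v: "vertex s ?z (a # \<rho>) (Suc k) = vertex s z \<pi> k" if "k \<le> length \<rho>" for k
        using that dis pi in_set_takeD[of a k \<rho>] by (auto simp: vertex_def abs_vertex_def fun_eq_iff)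
      have "{..length (a # \<rho>)} - {0} = Suc ` {..length \<rho>}"
        by (simp add: image_Suc_atMost) auto
      hence "(\<lambda>i'. l (vertex s ?z (a # \<rho>) i')) ` ({..length (a # \<rho>)} - {0})
         = (\<lambda>i'. l (vertex s z \<pi> i')) ` {..length \<rho>}"
        using v by (simp add: image_image)
      also have "{..length \<rho>} = {..length \<pi>} - {i}" using pi 2 by auto
      also have "(\<lambda>i'. l (vertex s z \<pi> i')) ` ({..length \<pi>} - {i}) = orthant_labels s (a # \<rho>)"
        using lab 2 pi by (simp add: orthant_labels_def)
      finally have "(\<lambda>i'. l (vertex s ?z (a # \<rho>) i')) ` ({..length (a # \<rho>)} - {0}) =
        orthant_labels s (a # \<rho>)" .
      moreover have "z a < m" using c pi by (auto simp: cell_def)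
      ultimately have "f t \<in> ?A" using c' unfolding ft by (simp add: doors_def)
      moreover have "f (f t) = t" unfolding ft using t pi 2 by (simp add: f_def)
      ultimately show ?thesis using t 2 ft by simp
    next
      case 3
      let ?\<pi> = "\<pi>[i - 1 := \<pi> ! i, i := \<pi> ! (i - 1)]"
      have ft: "f t = (s, z, ?\<pi>, i)" using 3 t by (simp add: f_def)
      have st: "set ?\<pi> = set \<pi>" and dt: "distinct ?\<pi>" using 3 dis by (auto simp: set_swap distinct_swap)
      have c': "cell n m s z ?\<pi>" using c st dt by (auto simp: cell_def)
      have tk: "set (take k ?\<pi>) = set (take k \<pi>)" if "k \<noteq> i" for k
      proof (cases "k < i")
        case True thus ?thesis by simp
      next
        case False
        hence "take k ?\<pi> = (take k \<pi>)[i - 1 := take k \<pi> ! i, i := take k \<pi> ! (i - 1)]"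
          using that False 3 by (simp add: take_update_swap)
        moreover have "set ((take k \<pi>)[i - 1 := take k \<pi> ! i, i := take k \<pi> ! (i - 1)]) = set (take k \<pi>)"
          by (rule set_swap) (use that False 3 in auto)
        ultimately show ?thesis by (simp only:)
      qed
      hence "vertex s z ?\<pi> k = vertex s z \<pi> k" if "k \<noteq> i" for k
        using that by (simp add: vertex_def abs_vertex_def)
      hence "(\<lambda>i'. l (vertex s z ?\<pi> i')) ` ({..length ?\<pi>} - {i}) =
         (\<lambda>i'. l (vertex s z \<pi> i')) ` ({..length \<pi>} - {i})"
        by (intro image_cong) auto
      hence "f t \<in> ?A" using c' ft lab 3 st ne by (auto simp: doors_def orthant_labels_def)
      moreover have "?\<pi>[i - 1 := ?\<pi> ! i, i := ?\<pi> ! (i - 1)] = \<pi>"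
        using 3 by (auto simp: list_eq_iff_nth_eq nth_list_update)
      hence "f (f t) = t" unfolding ft using t 3 by (simp add: f_def)
      moreover have "?\<pi> ! i \<noteq> \<pi> ! i" using 3 dis by (simp add: nth_eq_iff_index_eq)
      hence "f t \<noteq> t" using ft t by auto
      ultimately show ?thesis by simp
    qed
  qed
  thus ?thesis using finite_doors by (intro even_card_involution[where f = f]) auto
qed


lemma parity_of_diff:
  assumes "finite A" "B \<subseteq> A" "even (card (A - B))"
  shows "even (card A) \<longleftrightarrow> even (card B)"
proof -
  have "card A = card (A - B) + card B"
    using assms by (metis card_Diff_subset card_mono finite_subset le_add_diff_inverse2)
  thus ?thesis using assms(3) by simp
qed

text \<open>
Suppose that no adjacent points have opposite labels, and count the doors modulo two in two ways. Within a
simplex, doors pair off except for those whose opposite vertex carries a new label \<open>(j, e)\<close>. Across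
facets, doors pair off except for the origin and the facets on the boundary. Inner boundary facets, on
which the last coordinate \<open>j\<close> vanishes, are the simplices one dimension lower that carry the new
label \<open>(j, e)\<close>, so they match the unpaired doors of the first count exactly. Hence the number of
outer boundary facets is odd, which is impossible because they come in antipodal pairs.
\<close>

theorem tucker_grid:
  fixes l :: "(nat \<Rightarrow> int) \<Rightarrow> nat \<times> int"
  assumes m: "0 < m"
    and l: "\<And>x. x \<in> grid n m \<Longrightarrow> fst (l x) < n \<and> (snd (l x) = 1 \<or> snd (l x) = - 1)"
    and odd: "\<And>x j. x \<in> grid n m \<Longrightarrow> j < n \<Longrightarrow> \<bar>x j\<bar> = m \<Longrightarrow>
        l (\<lambda>j. - x j) = (fst (l x), - snd (l x))"
  shows "\<exists>x\<in>grid n m. \<exists>y\<in>grid n m. (\<forall>j. \<bar>x j - y j\<bar> \<le> 1) \<and> l x = (fst (l y), - snd (l y))"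
proof (rule ccontr)
  assume "\<not> ?thesis"
  hence nocomp: "l x \<noteq> (fst (l y), - snd (l y))"
    if "x \<in> grid n m" "y \<in> grid n m" "\<And>j. \<bar>x j - y j\<bar> \<le> 1" for x y
    using that by blast
  define D where "D = doors n m l"
  \<comment> \<open>\<open>full\<close> and \<open>insert origin (inner \<union> outer)\<close> are the unpaired doors of the two counts.\<close>
  define full where "full = D \<inter> {(s, z, \<pi>, i). l (vertex s z \<pi> i) \<notin> orthant_labels s \<pi>}"
  define inner where "inner = D \<inter> {(s, z, \<pi>, i). \<pi> \<noteq> [] \<and> i = length \<pi> \<and> z (last \<pi>) = 0}"
  define outer where "outer = D \<inter> {(s, z, \<pi>, i). \<pi> \<noteq> [] \<and> i = 0 \<and> z (hd \<pi>) = m - 1}"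
  define origin :: "(nat \<Rightarrow> int) \<times> (nat \<Rightarrow> int) \<times> nat list \<times> nat" where
    "origin = (\<lambda>_. 0, \<lambda>_. 0, [], 0)"
  have fin: "finite D" unfolding D_def by (rule finite_doors)
  have grid: "vertex s z \<pi> k \<in> grid n m" if "cell n m s z \<pi>" for s z \<pi> k
    using vertex_in_grid[OF that] m by simp
  have cell0: "s = (\<lambda>_. 0) \<and> z = (\<lambda>_. 0)" if "cell n m s z []" for s z
    using that by (auto simp: cell_def)
  have D0: "{(s, z, \<pi>, i). \<pi> = []} \<inter> D = {origin}"
  proof (intro equalityI subsetI)
    fix t assume "t \<in> {(s, z, \<pi>, i). \<pi> = []} \<inter> D"
    then obtain s z i where t: "t = (s, z, [], i)" "cell n m s z []" "i = 0"
      by (auto simp: D_def doors_def)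
    thus "t \<in> {origin}" using cell0[OF t(2)] by (simp add: origin_def)
  next
    fix t assume "t \<in> {origin}"
    thus "t \<in> {(s, z, \<pi>, i). \<pi> = []} \<inter> D"
      by (simp add: D_def doors_def origin_def cell_def orthant_labels_def)
  qed
  have "even (card D) \<longleftrightarrow> even (card full)"
  proof (rule parity_of_diff)
    have "D - full = D - {(s, z, \<pi>, i). l (vertex s z \<pi> i) \<notin> orthant_labels s \<pi>}"
      by (auto simp: full_def)
    thus "even (card (D - full))" using parity_same_cell by (simp add: D_def)
  qed (use fin full_def in auto)
  moreover have "even (card D) \<longleftrightarrow> even (card (insert origin (inner \<union> outer)))"
  proof (rule parity_of_diff)
    have "origin \<in> D" using D0 by blast
    thus "insert origin (inner \<union> outer) \<subseteq> D" by (auto simp: inner_def outer_def)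
    have "D - insert origin (inner \<union> outer) = D - {(s, z, \<pi>, i). \<pi> = [] \<or> i = length \<pi> \<and> z (last \<pi>) = 0 \<or> i = 0 \<and> z (hd \<pi>) = m - 1}"
    proof (rule set_eqI)
      fix t :: "(nat \<Rightarrow> int) \<times> (nat \<Rightarrow> int) \<times> nat list \<times> nat" obtain s z \<pi> i where t: "t = (s, z, \<pi>, i)" by (cases t)
      have "t \<in> D \<Longrightarrow> \<pi> = [] \<longleftrightarrow> t = origin" using D0 t by (auto simp: set_eq_iff)
      thus "t \<in> D - insert origin (inner \<union> outer) \<longleftrightarrow> t \<in> D - {(s, z, \<pi>, i). \<pi> = [] \<or>
          i = length \<pi> \<and> z (last \<pi>) = 0 \<or> i = 0 \<and> z (hd \<pi>) = m - 1}"
        by (simp add: inner_def outer_def t) blast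
    qed
    thus "even (card (D - insert origin (inner \<union> outer)))"
      using parity_pivot by (simp add: D_def)
  qed (use fin in auto)
  moreover have "card (insert origin (inner \<union> outer)) = Suc (card inner + card outer)"
  proof -
    have "origin \<notin> inner \<union> outer" by (auto simp: origin_def inner_def outer_def)
    moreover have "inner \<inter> outer = {}" by (auto simp: inner_def outer_def)
    moreover have "finite inner" "finite outer" using fin by (auto simp: inner_def outer_def)
    ultimately show ?thesis by (simp add: card_Un_disjoint)
  qed
  moreover have "card full = card inner"
  proof -
    \<comment> \<open>A simplex with the extra label \<open>(j, e)\<close> is the facet \<open>x j = 0\<close> of a simplex in the orthant with the
      additional sign \<open>e\<close> at \<open>j\<close>, and \<open>(j, e)\<close> is the label that this orthant requires in addition.\<close>
    define g where "g = (\<lambda>(s :: nat \<Rightarrow> int, z :: nat \<Rightarrow> int, \<pi>, i).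
      let (j, e) = l (vertex s z \<pi> i) in (s(j := e), z, \<pi> @ [j], Suc (length \<pi>)))"
    have ext: "vertex (s(j := e)) z (\<pi> @ [j]) k = vertex s z \<pi> k"
      if "cell n m s z \<pi>" "j \<notin> set \<pi>" "k \<le> length \<pi>" for s z \<pi> j e k
      using that in_set_takeD[of j k \<pi>] by (auto simp: vertex_def abs_vertex_def cell_def fun_eq_iff)
    have "g ` full = inner"
    proof (intro equalityI subsetI)
      fix t' assume "t' \<in> g ` full"
      then obtain s z \<pi> i where f: "(s, z, \<pi>, i) \<in> full" and t': "t' = g (s, z, \<pi>, i)" by auto
      obtain j e where je: "l (vertex s z \<pi> i) = (j, e)" by (cases "l (vertex s z \<pi> i)")
      have c: "cell n m s z \<pi>" and i: "i \<le> length \<pi>"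
        and lab: "(\<lambda>i'. l (vertex s z \<pi> i')) ` ({..length \<pi>} - {i}) = orthant_labels s \<pi>"
        and new: "(j, e) \<notin> orthant_labels s \<pi>"
        using f je by (auto simp: full_def D_def doors_def)
      have j: "j < n" "e = 1 \<or> e = - 1" using l[OF grid[OF c, of i]] je by auto
      \<comment> \<open>A coordinate in use would make \<open>(j, e)\<close> opposite to a label that occurs in the same simplex.\<close>
      have jn: "j \<notin> set \<pi>"
      proof
        assume jp: "j \<in> set \<pi>"
        hence "(j, s j) \<in> orthant_labels s \<pi>" by (simp add: orthant_labels_def)
        then obtain k where k: "l (vertex s z \<pi> k) = (j, s j)" using lab by (metis imageE)
        have "s j = 1 \<or> s j = - 1" using c jp by (auto simp: cell_def)
        moreover have "s j \<noteq> e" using new jp by (auto simp: orthant_labels_def)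
        ultimately have "s j = - e" using j(2) by auto
        thus False using nocomp[OF grid[OF c, of k] grid[OF c, of i] vertices_adjacent[OF c]] k je by simp
      qed
      have c': "cell n m (s(j := e)) z (\<pi> @ [j])"
        using c j jn m by (auto simp: cell_def)
      have "(\<lambda>k. l (vertex (s(j := e)) z (\<pi> @ [j]) k)) ` ({..Suc (length \<pi>)} - {Suc (length \<pi>)}) =
         (\<lambda>k. l (vertex s z \<pi> k)) ` {..length \<pi>}"
        using ext[OF c jn] by (intro image_cong) auto
      also have "\<dots> = insert (j, e) (orthant_labels s \<pi>)"
      proof -
        have "{..length \<pi>} = insert i ({..length \<pi>} - {i})" using i by auto
        hence "(\<lambda>k. l (vertex s z \<pi> k)) ` {..length \<pi>} =
          insert (l (vertex s z \<pi> i)) ((\<lambda>k. l (vertex s z \<pi> k)) ` ({..length \<pi>} - {i}))"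
          by (metis image_insert)
        thus ?thesis using lab je by simp
      qed
      also have "\<dots> = orthant_labels (s(j := e)) (\<pi> @ [j])"
        using jn by (auto simp: orthant_labels_def)
      finally have "(\<lambda>k. l (vertex (s(j := e)) z (\<pi> @ [j]) k)) ` ({..Suc (length \<pi>)} - {Suc (length \<pi>)}) =
         orthant_labels (s(j := e)) (\<pi> @ [j])" .
      moreover have "z j = 0" using c jn by (auto simp: cell_def)
      ultimately show "t' \<in> inner" using c' je unfolding t' inner_def D_def doors_def g_def by simp
    next
      fix t' assume a: "t' \<in> inner"
      obtain s' z \<pi>' i' where t': "t' = (s', z, \<pi>', i')" by (cases t')
      obtain \<pi> j where pi: "\<pi>' = \<pi> @ [j]" using a t' by (cases \<pi>' rule: rev_cases) (auto simp: inner_def)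
      have i': "i' = Suc (length \<pi>)" and zj: "z j = 0" and c': "cell n m s' z (\<pi> @ [j])"
        and lab: "(\<lambda>k. l (vertex s' z (\<pi> @ [j]) k)) ` ({..Suc (length \<pi>)} - {Suc (length \<pi>)}) =
          orthant_labels s' (\<pi> @ [j])"
        using a t' pi by (auto simp: inner_def D_def doors_def)
      have jn: "j \<notin> set \<pi>" using c' by (auto simp: cell_def)
      define s where "s = s'(j := 0)"
      have c: "cell n m s z \<pi>" using c' zj jn by (auto simp: cell_def s_def)
      have s': "s' = s(j := s' j)" by (simp add: s_def)
      have e: "vertex s' z (\<pi> @ [j]) k = vertex s z \<pi> k" if "k \<le> length \<pi>" for k
        using ext[OF c jn that, of "s' j"] s' by simp
      have lab': "(\<lambda>k. l (vertex s z \<pi> k)) ` {..length \<pi>} = orthant_labels s' (\<pi> @ [j])"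
      proof -
        have "{..Suc (length \<pi>)} - {Suc (length \<pi>)} = {..length \<pi>}" by auto
        moreover have "(\<lambda>k. l (vertex s z \<pi> k)) ` {..length \<pi>} = (\<lambda>k. l (vertex s' z (\<pi> @ [j]) k)) ` {..length \<pi>}"
          using e by (intro image_cong) auto
        ultimately show ?thesis using lab by simp
      qed
      have "(j, s' j) \<in> orthant_labels s' (\<pi> @ [j])" by (simp add: orthant_labels_def)
      hence "(j, s' j) \<in> (\<lambda>k. l (vertex s z \<pi> k)) ` {..length \<pi>}" by (simp only: lab')
      then obtain i where i: "i \<le> length \<pi>" "l (vertex s z \<pi> i) = (j, s' j)" by auto
      have "card ((\<lambda>k. l (vertex s z \<pi> k)) ` {..length \<pi>}) = card {..length \<pi>}"
        unfolding lab' using c' by (subst card_orthant_labels) (auto simp: cell_def)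
      hence inj: "inj_on (\<lambda>k. l (vertex s z \<pi> k)) {..length \<pi>}" by (intro eq_card_imp_inj_on) auto
      have new: "(j, s' j) \<notin> orthant_labels s \<pi>" using jn by (auto simp: orthant_labels_def)
      have "(\<lambda>k. l (vertex s z \<pi> k)) ` ({..length \<pi>} - {i}) = orthant_labels s' (\<pi> @ [j]) - {(j, s' j)}"
        using inj_on_image_set_diff[OF inj, of "{..length \<pi>}" "{i}"] i lab' by auto
      also have "\<dots> = orthant_labels s \<pi>"
        using jn by (auto simp: orthant_labels_def s_def)
      finally have "(s, z, \<pi>, i) \<in> full"
        using c i new by (auto simp: full_def D_def doors_def)
      moreover have "g (s, z, \<pi>, i) = t'" using i s' t' pi i' by (simp add: g_def)
      ultimately show "t' \<in> g ` full" by (metis imageI)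
    qed
    moreover have "inj_on g full"
    proof (rule inj_onI)
      fix t1 t2 assume tt: "t1 \<in> full" "t2 \<in> full" "g t1 = g t2"
      obtain s1 z1 \<pi>1 i1 where t1: "t1 = (s1, z1, \<pi>1, i1)" by (cases t1)
      obtain s2 z2 \<pi>2 i2 where t2: "t2 = (s2, z2, \<pi>2, i2)" by (cases t2)
      have a: "(s1, z1, \<pi>1, i1) \<in> full" "(s2, z2, \<pi>2, i2) \<in> full"
        "g (s1, z1, \<pi>1, i1) = g (s2, z2, \<pi>2, i2)" using tt t1 t2 by auto
      obtain j e where je: "l (vertex s1 z1 \<pi>1 i1) = (j, e)" by (cases "l (vertex s1 z1 \<pi>1 i1)")
      obtain j' e' where je': "l (vertex s2 z2 \<pi>2 i2) = (j', e')" by (cases "l (vertex s2 z2 \<pi>2 i2)")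
      have eqs: "s1(j := e) = s2(j := e')" "z1 = z2" "\<pi>1 = \<pi>2" "j' = j"
        using a(3) by (auto simp: g_def je je')
      have "e = e'" using fun_cong[OF eqs(1), of j] by simp
      have jn: "j \<notin> set \<pi>1"
      proof -
        have "t \<in> full \<Longrightarrow> g t \<in> inner" for t using \<open>g ` full = inner\<close> by blast
        from this[OF a(1)] show ?thesis by (simp add: g_def je inner_def D_def doors_def cell_def)
      qed
      have "s1 j = 0" "s2 j = 0" using a(1,2) jn eqs by (auto simp: full_def D_def doors_def cell_def)
      have s: "s1 = s2"
      proof
        fix k show "s1 k = s2 k" using fun_cong[OF eqs(1), of k] \<open>s1 j = 0\<close> \<open>s2 j = 0\<close>
          by (cases "k = j") auto
      qed
      have "i1 = i2"
      proof (rule ccontr)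
        assume "i1 \<noteq> i2"
        hence "(j, e) \<in> (\<lambda>k. l (vertex s1 z1 \<pi>1 k)) ` ({..length \<pi>1} - {i1})"
          using a(2) eqs s je' \<open>e = e'\<close> by (intro image_eqI[of _ _ i2]) (auto simp: full_def D_def doors_def)
        thus False using a(1) je by (auto simp: full_def D_def doors_def)
      qed
      thus "t1 = t2" using eqs s t1 t2 by simp
    qed
    ultimately show ?thesis by (metis card_image)
  qed
  moreover have "even (card outer)"
  proof (rule even_card_involution[where f = "\<lambda>(s, z, \<pi>, i). (\<lambda>j. - s j, z, \<pi>, i)"])
    show "finite outer" using fin by (simp add: outer_def)
    fix t assume a: "t \<in> outer"
    obtain s z \<pi> i where t: "t = (s, z, \<pi>, i)" by (cases t)
    have c: "cell n m s z \<pi>" and ne: "\<pi> \<noteq> []" and i: "i = 0" and zh: "z (hd \<pi>) = m - 1"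
        and lab: "(\<lambda>i'. l (vertex s z \<pi> i')) ` ({..length \<pi>} - {0}) = orthant_labels s \<pi>"
      using a t by (auto simp: outer_def D_def doors_def)
    obtain h \<rho> where pi: "\<pi> = h # \<rho>" using ne by (cases \<pi>) auto
    have c': "cell n m (\<lambda>j. - s j) z \<pi>" using c by (auto simp: cell_def)
    have neg: "l (vertex (\<lambda>j. - s j) z \<pi> k) = (\<lambda>(j, e). (j, - e)) (l (vertex s z \<pi> k))"
      if k: "k \<in> {..length \<pi>} - {0}" for k
    proof -
      obtain k' where k': "k = Suc k'" using k by (cases k) auto
      have sh: "\<bar>s h\<bar> = 1" "h < n" using c pi by (auto simp: cell_def)
      have "\<bar>vertex s z \<pi> k h\<bar> = m" using zh pi k' sh m by (simp add: vertex_def abs_vertex_def abs_mult)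
      from odd[OF grid[OF c, of k] sh(2) this] show ?thesis
        by (simp add: vertex_def case_prod_beta)
    qed
    have "(\<lambda>k. l (vertex (\<lambda>j. - s j) z \<pi> k)) ` ({..length \<pi>} - {0})
      = (\<lambda>(j, e). (j, - e)) ` (\<lambda>k. l (vertex s z \<pi> k)) ` ({..length \<pi>} - {0})"
      unfolding image_image using neg by (intro image_cong) auto
    also have "\<dots> = orthant_labels (\<lambda>j. - s j) \<pi>" unfolding lab by (auto simp: orthant_labels_def image_image)
    finally show "(case t of (s, z, \<pi>, i) \<Rightarrow> (\<lambda>j. - s j, z, \<pi>, i)) \<in> outer"
      using c' ne zh unfolding t i by (simp add: outer_def D_def doors_def)
    show "(case case t of (s, z, \<pi>, i) \<Rightarrow> (\<lambda>j. - s j, z, \<pi>, i) of (s, z, \<pi>, i) \<Rightarrow> (\<lambda>j. - s j, z, \<pi>, i)) = t"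
      by (simp add: t)
    have "s h \<noteq> 0" using c pi by (auto simp: cell_def)
    hence "(\<lambda>j. - s j) \<noteq> s" by (auto dest!: fun_cong[where x = h])
    thus "(case t of (s, z, \<pi>, i) \<Rightarrow> (\<lambda>j. - s j, z, \<pi>, i)) \<noteq> t" by (simp add: t)
  qed
  ultimately show False by simp
qed

section \<open>The Borsuk--Ulam theorem on a cube\<close>

lemma tendsto_fun_iff:
  fixes f :: "'b \<Rightarrow> 'a \<Rightarrow> 'c :: topological_space"
  shows "(f \<longlongrightarrow> l) F \<longleftrightarrow> (\<forall>i. ((\<lambda>x. f x i) \<longlongrightarrow> l i) F)"
proof -
  have "(f \<longlongrightarrow> l) F \<longleftrightarrow> limitin (product_topology (\<lambda>_. euclidean) UNIV) f l F"
    by (simp add: euclidean_product_topology)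
  thus ?thesis by (simp add: limitin_componentwise)
qed

text \<open>
Tychonoff's theorem, in the sequential form available for countable products.
\<close>

lemma bounded_coordinates_convergent_subseq:
  fixes u :: "nat \<Rightarrow> nat \<Rightarrow> real"
  assumes "\<And>n i. \<bar>u n i\<bar> \<le> B i"
  obtains z r where "strict_mono r" "(u \<circ> r) \<longlonglongrightarrow> z"
proof -
  let ?K = "PiE UNIV (\<lambda>i. {- B i..B i})"
  have "compactin (product_topology (\<lambda>_. euclidean) UNIV) ?K"
    by (subst compactin_PiE) auto
  hence "compact ?K" by (simp add: euclidean_product_topology)
  hence "seq_compact ?K" by (rule compact_imp_seq_compact)
  moreover have "\<forall>n. u n \<in> ?K" using assms by (auto simp: abs_le_iff minus_le_iff)
  ultimately show ?thesis using that by (meson seq_compactE)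
qed

definition cube :: "nat \<Rightarrow> (nat \<Rightarrow> real) set" where
  "cube n = {x. (\<forall>j<n. \<bar>x j\<bar> \<le> 1) \<and> (\<forall>j\<ge>n. x j = 0)}"

lemma limit_in_cube:
  assumes "\<And>N. x N \<in> cube n" "x \<longlonglongrightarrow> z"
  shows "z \<in> cube n"
proof -
  have lim: "(\<lambda>N. x N j) \<longlonglongrightarrow> z j" for j using assms(2) by (simp add: tendsto_fun_iff)
  have "\<bar>z j\<bar> \<le> 1" if "j < n" for j
    using assms(1) that by (intro LIMSEQ_le_const2[OF tendsto_rabs[OF lim]]) (auto simp: cube_def)
  moreover have "z j = 0" if "j \<ge> n" for j
  proof -
    have "(\<lambda>N. x N j) = (\<lambda>_. 0)" using assms(1) that by (auto simp: cube_def)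
    thus ?thesis using lim[of j] by (simp add: LIMSEQ_const_iff)
  qed
  ultimately show ?thesis by (simp add: cube_def)
qed

text \<open>
Label a grid point by a coordinate \<open>i\<close> at which \<open>\<bar>f x i\<bar>\<close> is largest, and by the sign of \<open>f x i\<close>.
Tucker's lemma yields points \<open>x\<close>, \<open>y\<close> at distance at most the mesh size at which the dominating coordinate has
opposite signs, so that all of \<open>f x\<close> is controlled by the difference of \<open>f x\<close> and \<open>f y\<close>. A limit point, as the
mesh tends to zero, is a zero of \<open>f\<close>.
\<close>

theorem borsuk_ulam_cube:
  fixes f :: "(nat \<Rightarrow> real) \<Rightarrow> nat \<Rightarrow> real"
  assumes cont: "\<And>i. i < n \<Longrightarrow> continuous_on (cube n) (\<lambda>x. f x i)"
    and odd: "\<And>x j i. x \<in> cube n \<Longrightarrow> j < n \<Longrightarrow> \<bar>x j\<bar> = 1 \<Longrightarrow> i < n \<Longrightarrow>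
        f (\<lambda>j. - x j) i = - f x i"
  shows "\<exists>x\<in>cube n. \<forall>i<n. f x i = 0"
proof (rule ccontr)
  assume nz: "\<not> ?thesis"
  have "n > 0"
  proof (rule ccontr)
    assume "\<not> n > 0"
    moreover have "(\<lambda>_. 0) \<in> cube n" by (simp add: cube_def)
    ultimately show False using nz by blast
  qed
  define ix where "ix = (\<lambda>x. LEAST i. i < n \<and> (\<forall>j<n. \<bar>f x j\<bar> \<le> \<bar>f x i\<bar>))"
  have ix: "ix x < n \<and> (\<forall>j<n. \<bar>f x j\<bar> \<le> \<bar>f x (ix x)\<bar>)" for x
  proof -
    have "\<exists>i. i < n \<and> (\<forall>j<n. \<bar>f x j\<bar> \<le> \<bar>f x i\<bar>)"
    proof -
      have "Max ((\<lambda>j. \<bar>f x j\<bar>) ` {..<n}) \<in> (\<lambda>j. \<bar>f x j\<bar>) ` {..<n}"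
        using \<open>n > 0\<close> by (intro Max_in) auto
      then obtain i where "i < n" "Max ((\<lambda>j. \<bar>f x j\<bar>) ` {..<n}) = \<bar>f x i\<bar>" by auto
      thus ?thesis by (metis Max_ge finite_imageI finite_lessThan imageI lessThan_iff)
    qed
    thus ?thesis unfolding ix_def by (rule LeastI_ex)
  qed
  have fix_nz: "f x (ix x) \<noteq> 0" if "x \<in> cube n" for x
    using nz that ix[of x] by fastforce
  \<comment> \<open>The estimate sums over all coordinates so that it does not mention the dominating one, which may
    vary along the sequence.\<close>
  define close where "close N x y \<longleftrightarrow> x \<in> cube n \<and> y \<in> cube n \<and> (\<forall>j. \<bar>x j - y j\<bar> \<le> 1 / Suc N) \<and>
      (\<forall>j<n. (f x j)\<^sup>2 \<le> (\<Sum>i<n. \<bar>f x i\<bar> * \<bar>f x i - f y i\<bar>))" for N x y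
  have "\<exists>x y. close N x y" for N
  proof -
    define q where "q = (\<lambda>(x :: nat \<Rightarrow> int) j. real_of_int (x j) / Suc N)"
    define l where "l = (\<lambda>x. (ix (q x), if f (q x) (ix (q x)) > 0 then 1 else - 1 :: int))"
    have q: "q x \<in> cube n" if "x \<in> grid n (int (Suc N))" for x
    proof -
      have "\<bar>real_of_int (x j)\<bar> \<le> real (Suc N)" if "j < n" for j
        using \<open>x \<in> _\<close> that unfolding grid_def by (metis (mono_tags, lifting) mem_Collect_eq of_int_abs of_int_le_iff of_int_of_nat_eq)
      thus ?thesis using that by (auto simp: q_def cube_def grid_def)
    qed
    have "\<exists>x\<in>grid n (int (Suc N)). \<exists>y\<in>grid n (int (Suc N)). (\<forall>j. \<bar>x j - y j\<bar> \<le> 1) \<and> l x = (fst (l y), - snd (l y))"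
    proof (rule tucker_grid)
      show "0 < int (Suc N)" by simp
      show "fst (l x) < n \<and> (snd (l x) = 1 \<or> snd (l x) = - 1)" for x using ix by (simp add: l_def)
      fix x j assume x: "x \<in> grid n (int (Suc N))" "j < n" "\<bar>x j\<bar> = int (Suc N)"
      have "\<bar>q x j\<bar> = 1"
        using x(3) unfolding q_def by (metis abs_divide abs_of_nat divide_self of_int_abs of_int_of_nat_eq of_nat_0 of_nat_eq_iff Zero_not_Suc)
      hence neg: "f (q (\<lambda>j. - x j)) i = - f (q x) i" if "i < n" for i
        using odd[OF q[OF x(1)] x(2) _ that] by (simp add: q_def)
      hence "(\<lambda>i. i < n \<and> (\<forall>j<n. \<bar>f (q (\<lambda>j. - x j)) j\<bar> \<le> \<bar>f (q (\<lambda>j. - x j)) i\<bar>)) =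
          (\<lambda>i. i < n \<and> (\<forall>j<n. \<bar>f (q x) j\<bar> \<le> \<bar>f (q x) i\<bar>))"
        by (simp add: fun_eq_iff cong: conj_cong)
      hence "ix (q (\<lambda>j. - x j)) = ix (q x)" unfolding ix_def by (simp only:)
      thus "l (\<lambda>j. - x j) = (fst (l x), - snd (l x))"
        using neg[of "ix (q x)"] ix[of "q x"] fix_nz[OF q[OF x(1)]] by (auto simp: l_def)
    qed
    then obtain x y where x: "x \<in> grid n (int (Suc N))" and y: "y \<in> grid n (int (Suc N))"
      and d: "\<And>j. \<bar>x j - y j\<bar> \<le> 1" and lxy: "l x = (fst (l y), - snd (l y))" by blast
    define i where "i = ix (q x)"
    have i: "i < n" "ix (q y) = i" using lxy ix by (auto simp: l_def i_def)
    have sgn: "f (q x) i * f (q y) i \<le> 0"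
      using lxy i by (auto simp: l_def i_def mult_le_0_iff split: if_splits)
    have "(f (q x) j)\<^sup>2 \<le> (\<Sum>i<n. \<bar>f (q x) i\<bar> * \<bar>f (q x) i - f (q y) i\<bar>)" if "j < n" for j
    proof -
      have "(f (q x) j)\<^sup>2 \<le> (f (q x) i)\<^sup>2"
        using ix[of "q x"] that by (simp add: i_def abs_le_square_iff)
      also have "\<dots> \<le> (f (q x) i)\<^sup>2 - f (q x) i * f (q y) i" using sgn by simp
      also have "\<dots> = f (q x) i * (f (q x) i - f (q y) i)" by (simp add: power2_eq_square algebra_simps)
      also have "\<dots> \<le> \<bar>f (q x) i\<bar> * \<bar>f (q x) i - f (q y) i\<bar>" by (metis abs_ge_self abs_mult)
      also have "\<dots> \<le> (\<Sum>i<n. \<bar>f (q x) i\<bar> * \<bar>f (q x) i - f (q y) i\<bar>)"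
        using i by (intro member_le_sum) auto
      finally show ?thesis .
    qed
    moreover have "\<bar>q x j - q y j\<bar> \<le> 1 / Suc N" for j
    proof -
      have "\<bar>real_of_int (x j) - real_of_int (y j)\<bar> \<le> 1"
        using d[of j] by linarith
      thus ?thesis by (simp add: q_def divide_right_mono flip: diff_divide_distrib)
    qed
    ultimately have "close N (q x) (q y)" using q x y by (simp add: close_def)
    thus ?thesis by blast
  qed
  then obtain x y where "\<And>N. close N (x N) (y N)" by metis
  hence x: "x N \<in> cube n" and y: "y N \<in> cube n"
    and d: "\<bar>x N j - y N j\<bar> \<le> 1 / Suc N"
    and sq: "j < n \<Longrightarrow> (f (x N) j)\<^sup>2 \<le> (\<Sum>i<n. \<bar>f (x N) i\<bar> * \<bar>f (x N) i - f (y N) i\<bar>)" for N j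
    by (auto simp: close_def)
  have "\<bar>x N i\<bar> \<le> 1" for N i using x[of N] by (cases "i < n") (auto simp: cube_def)
  then obtain z r where r: "strict_mono r" and xz: "(x \<circ> r) \<longlonglongrightarrow> z"
    using bounded_coordinates_convergent_subseq[of x "\<lambda>_. 1"] by blast
  have "(\<lambda>N. y (r N)) \<longlonglongrightarrow> z"
    unfolding tendsto_fun_iff
  proof
    fix j
    have "(\<lambda>N. 1 / real (Suc N)) \<longlonglongrightarrow> 0" by (rule lim_1_over_n[THEN LIMSEQ_Suc])
    hence "(\<lambda>N. x N j - y N j) \<longlonglongrightarrow> 0"
      by (rule Lim_null_comparison[rotated]) (use d in auto)
    hence "(\<lambda>N. x (r N) j - y (r N) j) \<longlonglongrightarrow> 0" by (rule LIMSEQ_subseq_LIMSEQ[OF _ r, unfolded o_def])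
    moreover have "(\<lambda>N. x (r N) j) \<longlonglongrightarrow> z j" using xz by (simp add: tendsto_fun_iff)
    ultimately have "(\<lambda>N. x (r N) j - (x (r N) j - y (r N) j)) \<longlonglongrightarrow> z j - 0" by (intro tendsto_diff)
    thus "(\<lambda>N. y (r N) j) \<longlonglongrightarrow> z j" by simp
  qed
  moreover have z: "z \<in> cube n" by (rule limit_in_cube[OF _ xz]) (use x in auto)
  ultimately have fy: "(\<lambda>N. f (y (r N)) i) \<longlonglongrightarrow> f z i" if "i < n" for i
    using y by (intro continuous_on_tendsto_compose[OF cont[OF that]]) auto
  have fx: "(\<lambda>N. f (x (r N)) i) \<longlonglongrightarrow> f z i" if "i < n" for i
    using x xz z by (intro continuous_on_tendsto_compose[OF cont[OF that]]) (auto simp: o_def)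
  have "f z j = 0" if "j < n" for j
  proof -
    have "(\<lambda>N. \<Sum>i<n. \<bar>f (x (r N)) i\<bar> * \<bar>f (x (r N)) i - f (y (r N)) i\<bar>)
        \<longlonglongrightarrow> (\<Sum>i<n. \<bar>f z i\<bar> * \<bar>f z i - f z i\<bar>)"
      by (intro tendsto_intros fx fy) auto
    moreover have "(\<lambda>N. (f (x (r N)) j)\<^sup>2) \<longlonglongrightarrow> (f z j)\<^sup>2" by (intro tendsto_intros fx that)
    ultimately have "(f z j)\<^sup>2 \<le> (\<Sum>i<n. \<bar>f z i\<bar> * \<bar>f z i - f z i\<bar>)"
      using sq that by (intro LIMSEQ_le) auto
    thus ?thesis by simp
  qed
  thus False using nz z by blast
qed

section \<open>A minimax principle for even functions\<close>

definition nonzero_vecs :: "nat \<Rightarrow> (nat \<Rightarrow> real) set" where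
  "nonzero_vecs N = {u. (\<forall>i\<ge>N. u i = 0) \<and> u \<noteq> (\<lambda>_. 0)}"

definition euclid_norm :: "nat \<Rightarrow> (nat \<Rightarrow> real) \<Rightarrow> real" where
  "euclid_norm N u = sqrt (\<Sum>i<N. (u i)\<^sup>2)"

definition normalized :: "nat \<Rightarrow> (nat \<Rightarrow> real) \<Rightarrow> nat \<Rightarrow> real" where
  "normalized N u = (\<lambda>i. u i / euclid_norm N u)"

definition unit_sphere :: "nat \<Rightarrow> (nat \<Rightarrow> real) set" where
  "unit_sphere N = {u. (\<forall>i\<ge>N. u i = 0) \<and> (\<Sum>i<N. (u i)\<^sup>2) = 1}"

lemma unit_sphere_vecs: "u \<in> unit_sphere N \<Longrightarrow> u \<in> nonzero_vecs N"
  by (auto simp: unit_sphere_def nonzero_vecs_def)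

lemma euclid_norm_pos: "u \<in> nonzero_vecs N \<Longrightarrow> euclid_norm N u > 0"
proof -
  assume u: "u \<in> nonzero_vecs N"
  then obtain i where i: "u i \<noteq> 0" by (auto simp: nonzero_vecs_def)
  hence "i < N" using u by (auto simp: nonzero_vecs_def not_le[symmetric])
  have "0 < (u i)\<^sup>2" using i by simp
  also have "\<dots> \<le> (\<Sum>i<N. (u i)\<^sup>2)" using \<open>i < N\<close> by (intro member_le_sum) auto
  finally show ?thesis by (simp add: euclid_norm_def)
qed

lemma normalized_in_sphere: "u \<in> nonzero_vecs N \<Longrightarrow> normalized N u \<in> unit_sphere N"
  using euclid_norm_pos[of u N]
  by (auto simp: unit_sphere_def normalized_def nonzero_vecs_def power_divide euclid_norm_def sum_nonneg
      simp flip: sum_divide_distrib)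

lemma normalized_minus: "normalized N (\<lambda>i. - u i) = (\<lambda>i. - normalized N u i)"
  by (simp add: normalized_def euclid_norm_def)

lemma continuous_on_normalized:
  assumes "\<And>i. continuous_on S (\<lambda>x. f x i)" "\<And>x. x \<in> S \<Longrightarrow> f x \<in> nonzero_vecs N"
  shows "continuous_on S (\<lambda>x. normalized N (f x) i)"
proof -
  have "continuous_on S (\<lambda>x. euclid_norm N (f x))"
    unfolding euclid_norm_def by (intro continuous_intros assms)
  moreover have "\<forall>x\<in>S. euclid_norm N (f x) \<noteq> 0" using euclid_norm_pos assms(2) by fastforce
  ultimately show ?thesis unfolding normalized_def by (intro continuous_on_divide assms)
qed

text \<open>
A map of the cube that is odd on the boundary is half of an odd map of the sphere of dimension \<open>k\<close>: the cube
parametrises the upper hemisphere, its boundary the equator.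
\<close>

definition odd_spheres :: "nat \<Rightarrow> nat \<Rightarrow> ((nat \<Rightarrow> real) \<Rightarrow> nat \<Rightarrow> real) set" where
  "odd_spheres k N = {h. (\<forall>i. continuous_on (cube k) (\<lambda>x. h x i)) \<and> h ` cube k \<subseteq> unit_sphere N \<and>
     (\<forall>x\<in>cube k. \<forall>j<k. \<bar>x j\<bar> = 1 \<longrightarrow> h (\<lambda>j. - x j) = (\<lambda>i. - h x i))}"

text \<open>
The last coordinate of the hemisphere is the product of the \<open>1 - (x j)\<^sup>2\<close>, a continuous function that vanishes on the
boundary of the cube and is \<open>1\<close> at the origin.
\<close>

lemma standard_odd_sphere:
  assumes "k < N"
  shows "\<exists>h\<in>odd_spheres k N. \<forall>x\<in>cube k. \<forall>i>k. h x i = 0"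
proof -
  define g where "g = (\<lambda>x i. if i < k then x i else if i = k then (\<Prod>j<k. 1 - (x j)\<^sup>2) else 0 :: real)"
  have g: "g x \<in> nonzero_vecs N" for x
  proof -
    have "g x \<noteq> (\<lambda>_. 0)"
    proof
      assume z: "g x = (\<lambda>_. 0)"
      have "x j = 0" if "j < k" for j using fun_cong[OF z, of j] that by (simp add: g_def)
      hence "g x k = 1" by (simp add: g_def)
      thus False using z by simp
    qed
    thus ?thesis using assms by (auto simp: nonzero_vecs_def g_def)
  qed
  have cont: "continuous_on UNIV (\<lambda>x. g x i)" for i
    unfolding g_def by (cases "i < k"; cases "i = k") (auto intro!: continuous_intros)
  have "(\<lambda>x. normalized N (g x)) \<in> odd_spheres k N"
    unfolding odd_spheres_def
  proof (intro CollectI conjI allI ballI impI)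
    show "continuous_on (cube k) (\<lambda>x. normalized N (g x) i)" for i
      using g cont by (intro continuous_on_normalized) (auto intro: continuous_on_subset)
    show "(\<lambda>x. normalized N (g x)) ` cube k \<subseteq> unit_sphere N" using normalized_in_sphere g by auto
    fix x j assume x: "x \<in> cube k" "j < k" "\<bar>x j\<bar> = 1"
    hence "1 - (x j)\<^sup>2 = 0" by (metis diff_self one_power2 power2_abs)
    hence pr: "(\<Prod>j<k. 1 - (x j)\<^sup>2) = 0" using x(2) by (intro prod_zero) auto
    have "g (\<lambda>j. - x j) = (\<lambda>i. - g x i)" by (rule ext) (simp add: g_def pr del: prod_zero_iff)
    thus "normalized N (g (\<lambda>j. - x j)) = (\<lambda>i. - normalized N (g x) i)" by (simp add: normalized_minus)
  qed
  thus ?thesis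
    by (rule bexI[rotated]) (simp add: normalized_def g_def)
qed

text \<open>
Here \<open>G\<close> is the gradient of \<open>F\<close>. Let \<open>c\<close> be the infimum over all odd spheres of the bounds of \<open>F\<close> on them.
Comparison with the standard sphere gives \<open>c \<le> b\<close>, and \<open>a \<le> c\<close> because by Borsuk--Ulam each odd
sphere contains a vector whose first \<open>k\<close> coordinates vanish.

A step \<open>u - t * G u\<close> followed by normalisation is continuous and odd, so it maps odd spheres to odd spheres; it avoids
zero since \<open>G u\<close> is orthogonal to \<open>u\<close> by homogeneity. By the choice of \<open>c\<close>, such a step cannot
push \<open>F\<close> below \<open>c - \<delta>\<close> on all of the set \<open>F \<le> c + \<delta>\<close>. With the step size \<open>\<tau> n\<close> tending to zero and
\<open>\<delta>\<close> its square, the points where it fails to do so have an average slope of at most \<open>2 * \<tau> n\<close>, and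
they accumulate at a critical point of level \<open>c\<close>.
\<close>

theorem even_minimax:
  fixes F :: "(nat \<Rightarrow> real) \<Rightarrow> real" and G :: "(nat \<Rightarrow> real) \<Rightarrow> nat \<Rightarrow> real"
  assumes "k < N"
    and contF: "continuous_on (nonzero_vecs N) F"
    and contG: "\<And>i. continuous_on (nonzero_vecs N) (\<lambda>u. G u i)"
    and suppG: "\<And>u i. N \<le> i \<Longrightarrow> G u i = 0"
    and oddG: "\<And>u i. G (\<lambda>i. - u i) i = - G u i"
    and homF: "\<And>u c. u \<in> nonzero_vecs N \<Longrightarrow> c > 0 \<Longrightarrow> F (\<lambda>i. c * u i) = F u"
    and deriv: "\<And>u w t. (\<forall>i\<ge>N. w i = 0) \<Longrightarrow> (\<lambda>i. u i + t * w i) \<in> nonzero_vecs N \<Longrightarrow>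
       ((\<lambda>t. F (\<lambda>i. u i + t * w i)) has_real_derivative (\<Sum>i<N. w i * G (\<lambda>i. u i + t * w i) i)) (at t)"
    and lower: "\<And>u. u \<in> nonzero_vecs N \<Longrightarrow> \<forall>i<k. u i = 0 \<Longrightarrow> a \<le> F u"
    and upper: "\<And>u. u \<in> nonzero_vecs N \<Longrightarrow> \<forall>i>k. u i = 0 \<Longrightarrow> F u \<le> b"
  shows "\<exists>u\<in>nonzero_vecs N. (\<forall>i. G u i = 0) \<and> a \<le> F u \<and> F u \<le> b"
proof -
  define C where "C = {c. \<exists>h\<in>odd_spheres k N. \<forall>x\<in>cube k. F (h x) \<le> c}"
  define c where "c = Inf C"
  have sph: "h x \<in> unit_sphere N" if "h \<in> odd_spheres k N" "x \<in> cube k" for h x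
    using that by (auto simp: odd_spheres_def)
  have bC: "b \<in> C"
  proof -
    obtain h where h: "h \<in> odd_spheres k N" "\<And>x i. x \<in> cube k \<Longrightarrow> i > k \<Longrightarrow> h x i = 0"
      using standard_odd_sphere[OF \<open>k < N\<close>] by blast
    have "F (h x) \<le> b" if "x \<in> cube k" for x
      using upper[of "h x"] h sph[OF h(1) that] that unit_sphere_vecs by blast
    thus ?thesis using h(1) by (auto simp: C_def)
  qed
  have aC: "a \<le> c'" if c': "c' \<in> C" for c'
  proof -
    obtain h where h: "h \<in> odd_spheres k N" "\<And>x. x \<in> cube k \<Longrightarrow> F (h x) \<le> c'"
      using c' by (auto simp: C_def)
    have "\<exists>x\<in>cube k. \<forall>i<k. h x i = 0"
      by (rule borsuk_ulam_cube) (use h(1) in \<open>auto simp: odd_spheres_def\<close>)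
    then obtain x where x: "x \<in> cube k" "\<forall>i<k. h x i = 0" by blast
    have "a \<le> F (h x)" using lower[OF unit_sphere_vecs[OF sph[OF h(1) x(1)]] x(2)] .
    thus ?thesis using h(2)[OF x(1)] by simp
  qed
  have ac: "a \<le> c" unfolding c_def using bC aC by (intro cInf_greatest) auto
  have bdd: "bdd_below C" using aC by (auto simp: bdd_below_def)
  have cb: "c \<le> b" unfolding c_def using bC bdd by (rule cInf_lower)
  \<comment> \<open>Euler's relation for a function that is constant on rays.\<close>
  have radial: "(\<Sum>i<N. u i * G u i) = 0" if u: "u \<in> nonzero_vecs N" for u
  proof -
    have "((\<lambda>t. F (\<lambda>i. u i + t * u i)) has_real_derivative (\<Sum>i<N. u i * G (\<lambda>i. u i + 0 * u i) i)) (at 0)"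
      using u by (intro deriv) (auto simp: nonzero_vecs_def)
    moreover have "((\<lambda>t. F (\<lambda>i. u i + t * u i)) has_real_derivative 0) (at 0)"
    proof (rule has_field_derivative_transform_within[where d = 1])
      show "((\<lambda>t. F u) has_real_derivative 0) (at 0)" by simp
      show "F u = F (\<lambda>i. u i + t * u i)" if "dist t 0 < 1" for t :: real
        using homF[OF u, of "1 + t"] that by (auto simp: dist_real_def algebra_simps)
    qed simp_all
    ultimately show ?thesis by (simp add: DERIV_unique)
  qed
  have step_vecs: "(\<lambda>i. u i - t * G u i) \<in> nonzero_vecs N" if u: "u \<in> unit_sphere N" for u t
  proof -
    have "(\<Sum>i<N. (u i - t * G u i)\<^sup>2) =
       (\<Sum>i<N. (u i)\<^sup>2) - 2 * t * (\<Sum>i<N. u i * G u i) + (\<Sum>i<N. (t * G u i)\<^sup>2)"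
      by (simp add: power2_diff sum.distrib sum_subtractf sum_distrib_left algebra_simps)
    also have "\<dots> \<ge> 1"
      using u radial[OF unit_sphere_vecs[OF u]] by (simp add: unit_sphere_def sum_nonneg)
    finally have "(\<Sum>i<N. (u i - t * G u i)\<^sup>2) \<ge> 1" .
    moreover have "(\<lambda>i. u i - t * G u i) \<noteq> (\<lambda>_. 0)"
    proof
      assume z: "(\<lambda>i. u i - t * G u i) = (\<lambda>_. 0)"
      have "u i - t * G u i = 0" for i using fun_cong[OF z, of i] .
      hence "(\<Sum>i<N. (u i - t * G u i)\<^sup>2) = 0" by simp
      thus False using calculation by simp
    qed
    ultimately show ?thesis using u suppG by (auto simp: nonzero_vecs_def unit_sphere_def)
  qed
  have blocked: "\<exists>u\<in>unit_sphere N. F u \<le> c + \<delta> \<and> c - \<delta> < F (\<lambda>i. u i - t * G u i)"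
    if "\<delta> > 0" for t \<delta>
  proof (rule ccontr)
    assume neg: "\<not> ?thesis"
    obtain c' where "c' \<in> C" "c' < c + \<delta>"
      using cInf_lessD[of C "c + \<delta>"] bC \<open>\<delta> > 0\<close> by (auto simp: c_def)
    then obtain h where h: "h \<in> odd_spheres k N" and "\<And>x. x \<in> cube k \<Longrightarrow> F (h x) \<le> c'"
      by (auto simp: C_def)
    hence hc: "F (h x) \<le> c + \<delta>" if "x \<in> cube k" for x
      using that \<open>c' < c + \<delta>\<close> by fastforce
    define h' where "h' = (\<lambda>x. normalized N (\<lambda>i. h x i - t * G (h x) i))"
    have hcont: "continuous_on (cube k) h"
      using h by (intro continuous_on_coordinatewise_then_product) (auto simp: odd_spheres_def)
    have hv: "h ` cube k \<subseteq> nonzero_vecs N" using sph[OF h] unit_sphere_vecs by blast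
    have Fh': "F (h' x) \<le> c - \<delta>" if x: "x \<in> cube k" for x
    proof -
      have v: "(\<lambda>i. h x i - t * G (h x) i) \<in> nonzero_vecs N" using step_vecs sph[OF h x] .
      have "F (h' x) = F (\<lambda>i. h x i - t * G (h x) i)"
        using homF[OF v, of "inverse (euclid_norm N (\<lambda>i. h x i - t * G (h x) i))"] euclid_norm_pos[OF v]
        by (simp add: h'_def normalized_def field_simps)
      also have "\<dots> \<le> c - \<delta>" using neg hc[OF x] sph[OF h x] by force
      finally show ?thesis .
    qed
    have "h' \<in> odd_spheres k N"
      unfolding odd_spheres_def
    proof (intro CollectI conjI allI ballI impI)
      have "continuous_on (cube k) (\<lambda>x. G (h x) i)" for i
        using continuous_on_compose2[OF contG hcont hv] .
      moreover have "continuous_on (cube k) (\<lambda>x. h x i)" for i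
        using hcont by (rule continuous_on_product_then_coordinatewise)
      ultimately show "continuous_on (cube k) (\<lambda>x. h' x i)" for i
        unfolding h'_def using step_vecs sph[OF h]
        by (intro continuous_on_normalized continuous_intros) auto
      show "h' ` cube k \<subseteq> unit_sphere N"
        unfolding h'_def using step_vecs sph[OF h] normalized_in_sphere by blast
      fix x j assume "x \<in> cube k" "j < k" "\<bar>x j\<bar> = 1"
      hence "h (\<lambda>j. - x j) = (\<lambda>i. - h x i)" using h by (auto simp: odd_spheres_def)
      thus "h' (\<lambda>j. - x j) = (\<lambda>i. - h' x i)"
        using normalized_minus[of N "\<lambda>i. h x i - t * G (h x) i"] by (simp add: h'_def oddG)
    qed
    hence "c - \<delta> \<in> C" using Fh' by (auto simp: C_def)
    hence "c \<le> c - \<delta>" unfolding c_def using bdd by (rule cInf_lower)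
    thus False using that by simp
  qed
  define \<tau> where "\<tau> = (\<lambda>n. 1 / real (Suc n))"
  have \<tau>: "\<tau> n > 0" for n by (simp add: \<tau>_def)
  have "\<exists>u. u \<in> unit_sphere N \<and> F u \<le> c + (\<tau> n)\<^sup>2 \<and> c - (\<tau> n)\<^sup>2 < F (\<lambda>i. u i - \<tau> n * G u i)" for n
    using blocked[of "(\<tau> n)\<^sup>2" "\<tau> n"] \<tau>[of n] by auto
  then obtain u where u: "\<And>n. u n \<in> unit_sphere N" and Fu: "\<And>n. F (u n) \<le> c + (\<tau> n)\<^sup>2"
    and Fy: "\<And>n. c - (\<tau> n)\<^sup>2 < F (\<lambda>i. u n i - \<tau> n * G (u n) i)" by metis
  have slope: "\<exists>s. 0 < s \<and> s < \<tau> n \<and> (\<Sum>i<N. G (u n) i * G (\<lambda>i. u n i - s * G (u n) i) i) \<le> 2 * \<tau> n" for n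
  proof -
    define w where "w = (\<lambda>i. - G (u n) i)"
    have w: "\<forall>i\<ge>N. w i = 0" "\<And>t. (\<lambda>i. u n i + t * w i) \<in> nonzero_vecs N"
      using suppG step_vecs[OF u] by (auto simp: w_def)
    obtain s where s: "0 < s" "s < \<tau> n" and
      "F (\<lambda>i. u n i + \<tau> n * w i) - F (\<lambda>i. u n i + 0 * w i) =
        (\<tau> n - 0) * (\<Sum>i<N. w i * G (\<lambda>i. u n i + s * w i) i)"
      using MVT2[OF \<tau>[of n], of "\<lambda>t. F (\<lambda>i. u n i + t * w i)"
          "\<lambda>t. \<Sum>i<N. w i * G (\<lambda>i. u n i + t * w i) i", OF deriv[OF w(1) w(2)]] by auto
    hence eq: "F (\<lambda>i. u n i - \<tau> n * G (u n) i) - F (u n) =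
        - (\<tau> n * (\<Sum>i<N. G (u n) i * G (\<lambda>i. u n i - s * G (u n) i) i))"
      by (simp add: w_def sum_negf)
    hence "\<tau> n * (\<Sum>i<N. G (u n) i * G (\<lambda>i. u n i - s * G (u n) i) i) \<le> \<tau> n * (2 * \<tau> n)"
      using Fu[of n] Fy[of n] by (simp add: power2_eq_square)
    thus ?thesis using s \<tau>[of n] by (metis mult_le_cancel_left_pos)
  qed
  then obtain s where s: "\<And>n. 0 < s n" "\<And>n. s n < \<tau> n"
    and sG: "\<And>n. (\<Sum>i<N. G (u n) i * G (\<lambda>i. u n i - s n * G (u n) i) i) \<le> 2 * \<tau> n" by metis
  have "\<bar>u n i\<bar> \<le> 1" for n i
  proof (cases "i < N")
    case True
    have "(u n i)\<^sup>2 \<le> (\<Sum>i<N. (u n i)\<^sup>2)" using True by (intro member_le_sum) auto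
    thus ?thesis using u[of n] by (simp add: unit_sphere_def abs_square_le_1)
  qed (use u in \<open>auto simp: unit_sphere_def\<close>)
  then obtain z r where r: "strict_mono r" and "(u \<circ> r) \<longlonglongrightarrow> z"
    using bounded_coordinates_convergent_subseq[of u "\<lambda>_. 1"] by blast
  hence uz: "(\<lambda>n. u (r n) i) \<longlonglongrightarrow> z i" for i by (simp add: tendsto_fun_iff)
  have z: "z \<in> unit_sphere N"
    unfolding unit_sphere_def
  proof (intro CollectI conjI allI impI)
    fix i assume "N \<le> i"
    hence "(\<lambda>n. u (r n) i) = (\<lambda>_. 0)" using u by (auto simp: unit_sphere_def)
    thus "z i = 0" using uz[of i] by (simp add: LIMSEQ_const_iff)
  next
    have "(\<lambda>n. \<Sum>i<N. (u (r n) i)\<^sup>2) \<longlonglongrightarrow> (\<Sum>i<N. (z i)\<^sup>2)" by (intro tendsto_intros uz)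
    moreover have "(\<lambda>n. \<Sum>i<N. (u (r n) i)\<^sup>2) = (\<lambda>_. 1)" using u by (auto simp: unit_sphere_def)
    ultimately show "(\<Sum>i<N. (z i)\<^sup>2) = 1" by (simp add: LIMSEQ_const_iff)
  qed
  hence zv: "z \<in> nonzero_vecs N" by (rule unit_sphere_vecs)
  have lim: "f \<longlonglongrightarrow> z \<Longrightarrow> (\<And>n. f n \<in> nonzero_vecs N) \<Longrightarrow> (\<lambda>n. G (f n) i) \<longlonglongrightarrow> G z i"
    "f \<longlonglongrightarrow> z \<Longrightarrow> (\<And>n. f n \<in> nonzero_vecs N) \<Longrightarrow> (\<lambda>n. F (f n)) \<longlonglongrightarrow> F z" for f i
    using zv by (auto intro: continuous_on_tendsto_compose[OF contG] continuous_on_tendsto_compose[OF contF])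
  have "\<tau> \<longlonglongrightarrow> 0" unfolding \<tau>_def by (rule lim_1_over_n[THEN LIMSEQ_Suc])
  hence \<tau>0: "(\<lambda>n. \<tau> (r n)) \<longlonglongrightarrow> 0" using LIMSEQ_subseq_LIMSEQ[OF _ r] by (auto simp: o_def)
  have s0: "(\<lambda>n. s (r n)) \<longlonglongrightarrow> 0"
    by (rule tendsto_sandwich[OF _ _ tendsto_const \<tau>0]) (use s in \<open>auto simp: less_imp_le\<close>)
  have uv: "u n \<in> nonzero_vecs N" for n using u unit_sphere_vecs by blast
  have Gu: "(\<lambda>n. G (u (r n)) i) \<longlonglongrightarrow> G z i" for i
    by (rule lim(1)) (use uz uv in \<open>auto simp: tendsto_fun_iff\<close>)
  have shift: "(\<lambda>n i. u (r n) i - \<sigma> n * G (u (r n)) i) \<longlonglongrightarrow> z" if "\<sigma> \<longlonglongrightarrow> 0" for \<sigma>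
    unfolding tendsto_fun_iff
  proof
    fix i
    have "(\<lambda>n. u (r n) i - \<sigma> n * G (u (r n)) i) \<longlonglongrightarrow> z i - 0 * G z i"
      by (intro tendsto_intros uz Gu that)
    thus "(\<lambda>n. u (r n) i - \<sigma> n * G (u (r n)) i) \<longlonglongrightarrow> z i" by simp
  qed
  have "F z \<le> c"
  proof -
    have "(\<lambda>n. c + (\<tau> (r n))\<^sup>2) \<longlonglongrightarrow> c + 0\<^sup>2" by (intro tendsto_intros \<tau>0)
    moreover have "(\<lambda>n. F (u (r n))) \<longlonglongrightarrow> F z"
      by (rule lim(2)) (use uz uv in \<open>auto simp: tendsto_fun_iff\<close>)
    ultimately have "F z \<le> c + 0\<^sup>2" using Fu by (intro LIMSEQ_le) auto
    thus ?thesis by simp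
  qed
  moreover have "c \<le> F z"
  proof -
    have "(\<lambda>n. c - (\<tau> (r n))\<^sup>2) \<longlonglongrightarrow> c - 0\<^sup>2" by (intro tendsto_intros \<tau>0)
    moreover have "(\<lambda>n. F (\<lambda>i. u (r n) i - \<tau> (r n) * G (u (r n)) i)) \<longlonglongrightarrow> F z"
      by (rule lim(2)) (use shift[OF \<tau>0] step_vecs u in auto)
    ultimately have "c - 0\<^sup>2 \<le> F z" using Fy by (intro LIMSEQ_le) (auto intro: less_imp_le)
    thus ?thesis by simp
  qed
  moreover have "G z i = 0" for i
  proof -
    have "(\<lambda>n. G (\<lambda>i. u (r n) i - s (r n) * G (u (r n)) i) i) \<longlonglongrightarrow> G z i" for i
      by (rule lim(1)) (use shift[OF s0] step_vecs u in auto)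
    hence "(\<lambda>n. \<Sum>i<N. G (u (r n)) i * G (\<lambda>i. u (r n) i - s (r n) * G (u (r n)) i) i)
        \<longlonglongrightarrow> (\<Sum>i<N. G z i * G z i)"
      by (intro tendsto_intros Gu)
    moreover have "(\<lambda>n. 2 * \<tau> (r n)) \<longlonglongrightarrow> 2 * 0" by (intro tendsto_intros \<tau>0)
    ultimately have "(\<Sum>i<N. G z i * G z i) \<le> 2 * 0"
      by (rule LIMSEQ_le) (use sG in blast)
    hence "(\<Sum>i<N. (G z i)\<^sup>2) = 0" by (simp add: power2_eq_square sum_nonneg antisym)
    hence "i < N \<Longrightarrow> (G z i)\<^sup>2 = 0" by (simp add: sum_nonneg_eq_0_iff)
    thus ?thesis using suppG by (cases "i < N") auto
  qed
  ultimately show ?thesis using zv ac cb by (intro bexI[of _ z]) auto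
qed

section \<open>Powers and logarithms of one real variable\<close>

text \<open>
The derivative of \<open>\<bar>t\<bar> powr p / p\<close>.
\<close>

definition signed_powr :: "real \<Rightarrow> real \<Rightarrow> real" where
  "signed_powr p t = \<bar>t\<bar> powr (p - 2) * t"

lemma signed_powr_0 [simp]: "signed_powr p 0 = 0"
  by (simp add: signed_powr_def)

lemma signed_powr_minus: "signed_powr p (- t) = - signed_powr p t"
  by (simp add: signed_powr_def)

lemma signed_powr_mult: "c > 0 \<Longrightarrow> signed_powr p (c * t) = c powr (p - 1) * signed_powr p t"
  by (cases "t = 0") (auto simp: signed_powr_def abs_mult powr_mult powr_diff power2_eq_square
      powr_numeral)

lemma signed_powr_times_self: "signed_powr p t * t = \<bar>t\<bar> powr p"
proof (cases "t = 0")
  case False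
  have "signed_powr p t * t = \<bar>t\<bar> powr (p - 2) * \<bar>t\<bar> powr 2"
    using False by (simp add: signed_powr_def powr_numeral power2_eq_square)
  also have "\<dots> = \<bar>t\<bar> powr p" by (simp only: powr_add[symmetric]) simp
  finally show ?thesis .
qed simp

lemma abs_signed_powr: "\<bar>signed_powr p t\<bar> = \<bar>t\<bar> powr (p - 1)"
proof (cases "t = 0")
  case False
  have "\<bar>signed_powr p t\<bar> = \<bar>t\<bar> powr (p - 2) * \<bar>t\<bar> powr 1"
    using False by (simp add: signed_powr_def abs_mult)
  also have "\<dots> = \<bar>t\<bar> powr (p - 1)" by (simp only: powr_add[symmetric]) simp
  finally show ?thesis .
qed simp

text \<open>
Half of the power absorbs the logarithm.
\<close>

lemma abs_powr_mult_ln_le: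
  fixes q t :: real
  assumes "q > 0" "\<bar>t\<bar> \<le> 1"
  shows "\<bar>\<bar>t\<bar> powr q * ln \<bar>t\<bar>\<bar> \<le> 2 / q * \<bar>t\<bar> powr (q / 2)"
proof (cases "t = 0")
  case False
  hence t: "\<bar>t\<bar> > 0" by simp
  have "ln (1 / \<bar>t\<bar>) \<le> (1 / \<bar>t\<bar>) powr (q / 2) / (q / 2)"
    using assms t by (intro ln_powr_bound) auto
  hence ln: "\<bar>ln \<bar>t\<bar>\<bar> \<le> 2 / q * \<bar>t\<bar> powr (- q / 2)"
    using t assms by (simp add: ln_div powr_divide powr_minus_divide field_simps)
  have "\<bar>\<bar>t\<bar> powr q * ln \<bar>t\<bar>\<bar> = \<bar>t\<bar> powr q * \<bar>ln \<bar>t\<bar>\<bar>" by (simp add: abs_mult)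
  also have "\<dots> \<le> \<bar>t\<bar> powr q * (2 / q * \<bar>t\<bar> powr (- q / 2))"
    using ln by (intro mult_left_mono) auto
  also have "\<dots> = 2 / q * (\<bar>t\<bar> powr q * \<bar>t\<bar> powr (- q / 2))" by simp
  also have "\<bar>t\<bar> powr q * \<bar>t\<bar> powr (- q / 2) = \<bar>t\<bar> powr (q / 2)" by (simp only: powr_add[symmetric]) simp
  finally show ?thesis .
qed simp

lemma tendsto_abs_powr_0:
  assumes "(q::real) > 0"
  shows "((\<lambda>t. \<bar>t\<bar> powr q) \<longlongrightarrow> 0) (at (0::real))"
proof -
  have "isCont (\<lambda>t::real. \<bar>t\<bar> powr q) 0"
    using assms by (intro continuous_intros) auto
  thus ?thesis using assms by (simp add: isCont_def)
qed

lemma tendsto_abs_powr_mult_ln_0: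
  assumes "(q::real) > 0"
  shows "((\<lambda>t. \<bar>t\<bar> powr q * ln \<bar>t\<bar>) \<longlongrightarrow> 0) (at (0::real))"
proof (rule Lim_null_comparison)
  show "\<forall>\<^sub>F t in at (0::real). norm (\<bar>t\<bar> powr q * ln \<bar>t\<bar>) \<le> 2 / q * \<bar>t\<bar> powr (q / 2)"
    unfolding eventually_at real_norm_def
  proof (intro exI[of _ 1] conjI ballI impI)
    fix t :: real assume "t \<noteq> 0 \<and> dist t 0 < 1"
    thus "\<bar>\<bar>t\<bar> powr q * ln \<bar>t\<bar>\<bar> \<le> 2 / q * \<bar>t\<bar> powr (q / 2)"
      by (intro abs_powr_mult_ln_le assms) (simp add: dist_real_def)
  qed simp
  have "((\<lambda>t. 2 / q * \<bar>t\<bar> powr (q / 2)) \<longlongrightarrow> 2 / q * 0) (at (0::real))"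
    using assms by (intro tendsto_intros tendsto_abs_powr_0) auto
  thus "((\<lambda>t. 2 / q * \<bar>t\<bar> powr (q / 2)) \<longlongrightarrow> 0) (at (0::real))" by simp
qed

lemma continuous_signed_powr:
  assumes "p > 1"
  shows "continuous_on UNIV (signed_powr p)"
proof (rule continuous_at_imp_continuous_on, rule ballI)
  fix t :: real
  show "isCont (signed_powr p) t"
  proof (cases "t = 0")
    case True
    have "((\<lambda>t. signed_powr p t) \<longlongrightarrow> 0) (at 0)"
      by (rule Lim_null_comparison[OF _ tendsto_abs_powr_0[of "p - 1"]])
        (use assms in \<open>auto simp: abs_signed_powr\<close>)
    thus ?thesis using True by (simp add: isCont_def)
  next
    case False
    thus ?thesis unfolding signed_powr_def by (intro continuous_intros) auto
  qed
qed

lemma continuous_signed_powr_ln: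
  assumes "p > 1"
  shows "continuous_on UNIV (\<lambda>t. signed_powr p t * ln (\<bar>t\<bar> powr p))"
proof (rule continuous_at_imp_continuous_on, rule ballI)
  fix t :: real
  show "isCont (\<lambda>t. signed_powr p t * ln (\<bar>t\<bar> powr p)) t"
  proof (cases "t = 0")
    case True
    have "((\<lambda>t. p * \<bar>\<bar>t\<bar> powr (p - 1) * ln \<bar>t\<bar>\<bar>) \<longlongrightarrow> p * \<bar>0\<bar>) (at (0::real))"
      using assms by (intro tendsto_intros tendsto_abs_powr_mult_ln_0) auto
    hence "((\<lambda>t. p * \<bar>\<bar>t\<bar> powr (p - 1) * ln \<bar>t\<bar>\<bar>) \<longlongrightarrow> 0) (at (0::real))" by simp
    hence "((\<lambda>t. signed_powr p t * ln (\<bar>t\<bar> powr p)) \<longlongrightarrow> 0) (at 0)"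
      by (rule Lim_null_comparison[rotated])
        (use assms in \<open>auto simp: abs_signed_powr abs_mult ln_powr\<close>)
    thus ?thesis using True by (simp add: isCont_def)
  next
    case False
    moreover have "isCont (signed_powr p) t"
      using continuous_signed_powr[OF assms] by (simp add: continuous_on_eq_continuous_at)
    ultimately show ?thesis by (intro continuous_intros) auto
  qed
qed

lemma DERIV_abs_powr:
  assumes "p > 1"
  shows "((\<lambda>t. \<bar>t\<bar> powr p) has_real_derivative p * signed_powr p t) (at t)"
proof (cases "t = 0")
  case True
  have "((\<lambda>h. \<bar>h\<bar> powr p / h) \<longlongrightarrow> 0) (at (0::real))"
  proof (rule Lim_null_comparison[OF _ tendsto_abs_powr_0[of "p - 1"]])
    show "\<forall>\<^sub>F h in at (0::real). norm (\<bar>h\<bar> powr p / h) \<le> \<bar>h\<bar> powr (p - 1)"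
      by (intro always_eventually allI) (simp add: powr_diff abs_mult)
  qed (use assms in auto)
  thus ?thesis using True by (simp add: DERIV_def)
next
  case False
  consider "t > 0" | "t < 0" using False by linarith
  thus ?thesis
  proof cases
    case 1
    have "((\<lambda>t. t powr p) has_real_derivative p * t powr (p - 1)) (at t)"
      using 1 by (intro has_real_derivative_powr)
    moreover have "\<forall>\<^sub>F s in nhds t. s powr p = \<bar>s\<bar> powr p"
      using 1 by (intro eventually_mono[OF eventually_nhds_in_open[of "{0<..}"]]) auto
    moreover have "p * t powr (p - 1) = p * signed_powr p t"
      using 1 by (simp add: signed_powr_def powr_diff powr_numeral power2_eq_square)
    ultimately show ?thesis using DERIV_cong_ev by fastforce
  next
    case 2
    have "((\<lambda>t. (- t) powr p) has_real_derivative p * (- t) powr (p - 1) * (- 1)) (at t)"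
      using 2 by (auto intro!: derivative_eq_intros)
    moreover have "\<forall>\<^sub>F s in nhds t. (- s) powr p = \<bar>s\<bar> powr p"
      using 2 by (intro eventually_mono[OF eventually_nhds_in_open[of "{..<0}"]]) auto
    moreover have "p * (- t) powr (p - 1) * (- 1) = p * signed_powr p t"
      using 2 by (simp add: signed_powr_def powr_diff powr_numeral power2_eq_square)
    ultimately show ?thesis using DERIV_cong_ev by fastforce
  qed
qed

lemma DERIV_abs_powr_ln:
  assumes "p > 1"
  shows "((\<lambda>t. \<bar>t\<bar> powr p * ln (\<bar>t\<bar> powr p)) has_real_derivative
    p * (signed_powr p t * ln (\<bar>t\<bar> powr p) + signed_powr p t)) (at t)"
proof (cases "t = 0")
  case True
  have "((\<lambda>h. p * \<bar>\<bar>h\<bar> powr (p - 1) * ln \<bar>h\<bar>\<bar>) \<longlongrightarrow> p * \<bar>0\<bar>) (at (0::real))"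
    using assms by (intro tendsto_intros tendsto_abs_powr_mult_ln_0) auto
  hence "((\<lambda>h. p * \<bar>\<bar>h\<bar> powr (p - 1) * ln \<bar>h\<bar>\<bar>) \<longlongrightarrow> 0) (at (0::real))" by simp
  hence "((\<lambda>h. \<bar>h\<bar> powr p * ln (\<bar>h\<bar> powr p) / h) \<longlongrightarrow> 0) (at (0::real))"
    by (rule Lim_null_comparison[rotated])
      (use assms in \<open>auto simp: powr_diff abs_mult ln_powr mult.left_commute\<close>)
  thus ?thesis using True by (simp add: DERIV_def)
next
  case False
  have "((\<lambda>t. \<bar>t\<bar> powr p * ln (\<bar>t\<bar> powr p)) has_real_derivative
     p * signed_powr p t * ln (\<bar>t\<bar> powr p) + inverse (\<bar>t\<bar> powr p) * (p * signed_powr p t) * \<bar>t\<bar> powr p) (at t)"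
    using False by (intro DERIV_mult DERIV_chain2[OF DERIV_ln] DERIV_abs_powr assms) auto
  thus ?thesis using False by (simp add: algebra_simps)
qed

lemma abs_diff_powr_le:
  fixes a b p :: real
  assumes "p > 0"
  shows "\<bar>a - b\<bar> powr p \<le> 2 powr p * (\<bar>a\<bar> powr p + \<bar>b\<bar> powr p)"
proof -
  have "\<bar>a - b\<bar> powr p \<le> (2 * max \<bar>a\<bar> \<bar>b\<bar>) powr p"
    using assms by (intro powr_mono2) (auto simp: max_def)
  also have "\<dots> = 2 powr p * max \<bar>a\<bar> \<bar>b\<bar> powr p" by (simp add: powr_mult)
  also have "\<dots> \<le> 2 powr p * (\<bar>a\<bar> powr p + \<bar>b\<bar> powr p)"
    by (intro mult_left_mono) (auto simp: max_def)
  finally show ?thesis .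
qed

text \<open>
The logarithm lies below its tangent, applied to \<open>n / q\<close>. For \<open>q\<close> running through the summands of \<open>n\<close>, this bounds
the entropy.
\<close>

lemma mult_ln_ge:
  fixes q n :: real
  assumes "0 \<le> q" "0 < n"
  shows "q * ln n - n \<le> q * ln q"
proof (cases "q = 0")
  case False
  hence q: "q > 0" using assms by simp
  have "ln (n / q) \<le> n / q - 1" using q assms by (intro ln_le_minus_one) auto
  hence "q * ln (n / q) \<le> n - q" using q by (simp add: field_simps)
  thus ?thesis using q assms by (simp add: ln_div algebra_simps)
qed (use assms in auto)

section \<open>Finite Dirichlet problems\<close>

locale bounded_degree_graph =
  fixes E :: "'a \<Rightarrow> 'a \<Rightarrow> bool" and p :: real and C :: nat
  assumes p: "p > 1" and adj_sym: "E x y \<Longrightarrow> E y x"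
    and finite_nbrs: "finite {y. E y x}" and card_nbrs: "card {y. E y x} \<le> C"

text \<open>
The vertices are enumerated by natural numbers, so that \<open>{..<N}\<close> is an exhaustion of the graph.
In the functionals below \<open>R\<close> is a cutoff beyond the support of \<open>u\<close>; it has to be large enough to
contain the neighbours of the support, since the edges leaving the support contribute to the
Dirichlet energy.
\<close>

locale log_graph = bounded_degree_graph E p C
  for E :: "nat \<Rightarrow> nat \<Rightarrow> bool" and p :: real and C :: nat +
  fixes V :: "nat \<Rightarrow> real"
begin

\<comment> \<open>Keeps the edge indicator as a factor; the default rules turn it into a restriction of the range.\<close>
declare sum_of_bool_mult_eq [simp del] sum_mult_of_bool_eq [simp del]

definition mass :: "nat \<Rightarrow> (nat \<Rightarrow> real) \<Rightarrow> real" where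
  "mass R u = (\<Sum>x<R. \<bar>u x\<bar> powr p)"

definition dirichlet :: "nat \<Rightarrow> (nat \<Rightarrow> real) \<Rightarrow> real" where
  "dirichlet R u = (1/2) * (\<Sum>x<R. \<Sum>y<R. of_bool (E x y) * \<bar>u x - u y\<bar> powr p)"

definition energy :: "nat \<Rightarrow> (nat \<Rightarrow> real) \<Rightarrow> real" where
  "energy R u = dirichlet R u + (\<Sum>x<R. V x * \<bar>u x\<bar> powr p)
     - (\<Sum>x<R. \<bar>u x\<bar> powr p * ln (\<bar>u x\<bar> powr p))"

text \<open>
On functions with \<open>mass R u = 1\<close> this is the energy; the logarithm makes it constant on rays
(\<open>level_scale\<close>), because of the behaviour of the entropy term under scaling.
\<close>

definition level :: "nat \<Rightarrow> (nat \<Rightarrow> real) \<Rightarrow> real" where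
  "level R u = energy R u / mass R u + ln (mass R u)"

text \<open>
The defect of \<open>u\<close> in the equation with the Lagrange multiplier \<open>energy R u / mass R u\<close>. It is the gradient of
\<open>level\<close> up to the factor \<open>p / mass R u\<close> (\<open>DERIV_level\<close>).
\<close>

definition residual :: "nat \<Rightarrow> (nat \<Rightarrow> real) \<Rightarrow> nat \<Rightarrow> real" where
  "residual R u x = (\<Sum>y<R. of_bool (E x y) * signed_powr p (u x - u y)) + V x * signed_powr p (u x)
     - signed_powr p (u x) * ln (\<bar>u x\<bar> powr p) - energy R u / mass R u * signed_powr p (u x)"

lemma mass_pos:
  assumes "u \<in> nonzero_vecs N" "N \<le> R"
  shows "mass R u > 0"
proof -
  obtain i where i: "u i \<noteq> 0" using assms by (auto simp: nonzero_vecs_def)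
  hence "i < N" using assms by (auto simp: nonzero_vecs_def not_le[symmetric])
  have "0 < \<bar>u i\<bar> powr p" using i by simp
  also have "\<dots> \<le> mass R u"
    unfolding mass_def using \<open>i < N\<close> assms by (intro member_le_sum) auto
  finally show ?thesis .
qed

lemma DERIV_mass:
  "((\<lambda>t. mass R (\<lambda>i. u i + t * w i)) has_real_derivative
     p * (\<Sum>x<R. w x * signed_powr p (u x + t * w x))) (at t)"
proof -
  have "((\<lambda>t. \<bar>u x + t * w x\<bar> powr p) has_real_derivative p * signed_powr p (u x + t * w x) * w x) (at t)" for x
    by (rule DERIV_chain2[OF DERIV_abs_powr[OF p]]) (auto intro!: derivative_eq_intros)
  hence "((\<lambda>t. mass R (\<lambda>i. u i + t * w i)) has_real_derivative
     (\<Sum>x<R. p * signed_powr p (u x + t * w x) * w x)) (at t)"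
    unfolding mass_def by (intro DERIV_sum)
  thus ?thesis by (simp add: sum_distrib_left mult_ac)
qed

text \<open>
Summation by parts: interchanging \<open>x\<close> and \<open>y\<close> changes the sign of the difference but not the edge.
\<close>

lemma dirichlet_parts:
  "(1/2) * (\<Sum>x<R. \<Sum>y<R. of_bool (E x y) * (signed_powr p (v x - v y) * (w x - w y))) =
   (\<Sum>x<R. w x * (\<Sum>y<R. of_bool (E x y) * signed_powr p (v x - v y)))"
proof -
  let ?a = "\<lambda>x y. of_bool (E x y) * signed_powr p (v x - v y)"
  have anti: "?a y x = - ?a x y" for x y
    using signed_powr_minus[of p "v x - v y"] adj_sym[of x y] adj_sym[of y x] by (cases "E x y") auto
  have "(\<Sum>x<R. \<Sum>y<R. ?a x y * w y) = (\<Sum>x<R. \<Sum>y<R. ?a y x * w x)"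
    by (rule sum.swap)
  also have "\<dots> = - (\<Sum>x<R. \<Sum>y<R. ?a x y * w x)"
    unfolding sum_negf[symmetric] by (intro sum.cong refl) (subst anti, simp)
  finally have sw: "(\<Sum>x<R. \<Sum>y<R. ?a x y * w y) = - (\<Sum>x<R. \<Sum>y<R. ?a x y * w x)" .
  have "(\<Sum>x<R. \<Sum>y<R. of_bool (E x y) * (signed_powr p (v x - v y) * (w x - w y))) =
     (\<Sum>x<R. \<Sum>y<R. ?a x y * w x) - (\<Sum>x<R. \<Sum>y<R. ?a x y * w y)"
    by (simp only: sum_subtractf[symmetric]) (simp add: algebra_simps)
  also have "\<dots> = 2 * (\<Sum>x<R. \<Sum>y<R. ?a x y * w x)" using sw by simp
  finally show ?thesis by (simp add: sum_distrib_left mult_ac)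
qed

lemma DERIV_energy:
  "((\<lambda>t. energy R (\<lambda>i. u i + t * w i)) has_real_derivative
     p * (\<Sum>x<R. w x * (residual R (\<lambda>i. u i + t * w i) x
       + (energy R (\<lambda>i. u i + t * w i) / mass R (\<lambda>i. u i + t * w i) - 1) * signed_powr p (u x + t * w x)))) (at t)"
proof -
  define v where "v = (\<lambda>i. u i + t * w i)"
  let ?v = "\<lambda>t i. u i + t * w i"
  have d: "((\<lambda>t. of_bool (E x y) * \<bar>?v t x - ?v t y\<bar> powr p) has_real_derivative
      of_bool (E x y) * (p * signed_powr p (v x - v y) * (w x - w y))) (at t)" for x y
    unfolding v_def
    by (rule DERIV_cmult, rule DERIV_chain2[OF DERIV_abs_powr[OF p]]) (auto intro!: derivative_eq_intros)
  have "((\<lambda>t. dirichlet R (?v t)) has_real_derivative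
      (1/2) * (\<Sum>x<R. \<Sum>y<R. of_bool (E x y) * (p * signed_powr p (v x - v y) * (w x - w y)))) (at t)"
    unfolding dirichlet_def by (rule DERIV_cmult, rule DERIV_sum, rule DERIV_sum, rule d)
  also have "(1/2) * (\<Sum>x<R. \<Sum>y<R. of_bool (E x y) * (p * signed_powr p (v x - v y) * (w x - w y))) =
    p * ((1/2) * (\<Sum>x<R. \<Sum>y<R. of_bool (E x y) * (signed_powr p (v x - v y) * (w x - w y))))"
    by (simp add: sum_distrib_left mult_ac)
  also have "\<dots> = p * (\<Sum>x<R. w x * (\<Sum>y<R. of_bool (E x y) * signed_powr p (v x - v y)))"
    by (simp only: dirichlet_parts)
  finally have 1: "((\<lambda>t. dirichlet R (?v t)) has_real_derivative
     p * (\<Sum>x<R. w x * (\<Sum>y<R. of_bool (E x y) * signed_powr p (v x - v y)))) (at t)" .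
  have "((\<lambda>t. \<bar>?v t x\<bar> powr p) has_real_derivative p * signed_powr p (v x) * w x) (at t)" for x
    unfolding v_def
    by (rule DERIV_chain2[OF DERIV_abs_powr[OF p]]) (auto intro!: derivative_eq_intros)
  hence 2: "((\<lambda>t. \<Sum>x<R. V x * \<bar>?v t x\<bar> powr p) has_real_derivative (\<Sum>x<R. V x * (p * signed_powr p (v x) * w x))) (at t)"
    by (intro DERIV_sum DERIV_cmult)
  have "((\<lambda>t. \<bar>?v t x\<bar> powr p * ln (\<bar>?v t x\<bar> powr p)) has_real_derivative
      p * (signed_powr p (v x) * ln (\<bar>v x\<bar> powr p) + signed_powr p (v x)) * w x) (at t)" for x
    unfolding v_def
    by (rule DERIV_chain2[OF DERIV_abs_powr_ln[OF p]]) (auto intro!: derivative_eq_intros)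
  hence 3: "((\<lambda>t. \<Sum>x<R. \<bar>?v t x\<bar> powr p * ln (\<bar>?v t x\<bar> powr p)) has_real_derivative
      (\<Sum>x<R. p * (signed_powr p (v x) * ln (\<bar>v x\<bar> powr p) + signed_powr p (v x)) * w x)) (at t)"
    by (intro DERIV_sum)
  have "p * (\<Sum>x<R. w x * (\<Sum>y<R. of_bool (E x y) * signed_powr p (v x - v y)))
     + (\<Sum>x<R. V x * (p * signed_powr p (v x) * w x))
     - (\<Sum>x<R. p * (signed_powr p (v x) * ln (\<bar>v x\<bar> powr p) + signed_powr p (v x)) * w x)
     = p * (\<Sum>x<R. w x * (residual R v x + (energy R v / mass R v - 1) * signed_powr p (v x)))"
    unfolding residual_def sum_distrib_left[of p] sum.distrib[symmetric] sum_subtractf[symmetric]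
    by (intro sum.cong refl) (simp add: algebra_simps)
  thus ?thesis
    using DERIV_diff[OF DERIV_add[OF 1 2] 3] unfolding energy_def[symmetric] by (simp add: v_def)
qed

lemma DERIV_level:
  assumes "(\<lambda>i. u i + t * w i) \<in> nonzero_vecs N" "N \<le> R"
  shows "((\<lambda>t. level R (\<lambda>i. u i + t * w i)) has_real_derivative
     (\<Sum>x<R. w x * (p / mass R (\<lambda>i. u i + t * w i) * residual R (\<lambda>i. u i + t * w i) x))) (at t)"
proof -
  define v where "v = (\<lambda>i. u i + t * w i)"
  define m where "m = mass R v"
  define e where "e = energy R v"
  define A where "A = (\<Sum>x<R. w x * residual R v x)"
  define B where "B = (\<Sum>x<R. w x * signed_powr p (v x))"
  have m: "m > 0" unfolding m_def v_def using mass_pos[OF assms] .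
  have dm: "((\<lambda>t. mass R (\<lambda>i. u i + t * w i)) has_real_derivative p * B) (at t)"
    using DERIV_mass[of R u w t] by (simp add: B_def v_def)
  have de: "((\<lambda>t. energy R (\<lambda>i. u i + t * w i)) has_real_derivative p * (A + (e / m - 1) * B)) (at t)"
  proof -
    have "(\<Sum>x<R. w x * (residual R v x + (e / m - 1) * signed_powr p (v x))) = A + (e / m - 1) * B"
      unfolding A_def B_def sum_distrib_left sum.distrib[symmetric]
      by (intro sum.cong refl) (simp add: algebra_simps)
    thus ?thesis using DERIV_energy[of R u w t] by (simp add: e_def m_def v_def)
  qed
  have "((\<lambda>t. level R (\<lambda>i. u i + t * w i)) has_real_derivative
     (p * (A + (e / m - 1) * B) * m - e * (p * B)) / (m * m) + inverse m * (p * B)) (at t)"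
    unfolding level_def
    using m unfolding e_def m_def v_def
    by (intro DERIV_add DERIV_divide DERIV_chain2[OF DERIV_ln] dm de[unfolded e_def m_def v_def]) auto
  also have "(p * (A + (e / m - 1) * B) * m - e * (p * B)) / (m * m) + inverse m * (p * B) = p / m * A"
    using m by (simp add: field_simps)
  also have "\<dots> = (\<Sum>x<R. w x * (p / m * residual R v x))"
    unfolding A_def sum_distrib_left by (simp add: mult_ac)
  finally show ?thesis by (simp add: m_def v_def)
qed

lemma continuous_coord_comp:
  assumes "continuous_on UNIV g"
  shows "continuous_on S (\<lambda>u :: nat \<Rightarrow> real. g (u x))" "continuous_on S (\<lambda>u :: nat \<Rightarrow> real. g (u x - u y))"
  by (rule continuous_on_compose2[OF assms];
      auto intro!: continuous_intros continuous_on_subset[OF continuous_on_product_coordinates])+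

lemma continuous_abs_powr: "continuous_on UNIV (\<lambda>t :: real. \<bar>t\<bar> powr p)"
  using DERIV_abs_powr[OF p] by (intro DERIV_continuous_on) (auto intro: has_field_derivative_at_within)

lemma continuous_mass: "continuous_on S (mass R)"
  unfolding mass_def by (intro continuous_on_sum continuous_coord_comp(1)[OF continuous_abs_powr])

lemma continuous_energy: "continuous_on S (energy R)"
proof -
  note c = continuous_abs_powr
  have l: "continuous_on UNIV (\<lambda>t :: real. \<bar>t\<bar> powr p * ln (\<bar>t\<bar> powr p))"
    using DERIV_abs_powr_ln[OF p] by (intro DERIV_continuous_on) (auto intro: has_field_derivative_at_within)
  show ?thesis unfolding energy_def dirichlet_def
    by (intro continuous_intros continuous_coord_comp(1)[OF l] continuous_coord_comp[OF c])
qed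

lemma continuous_residual:
  assumes "N \<le> R"
  shows "continuous_on (nonzero_vecs N) (\<lambda>u. residual R u x)"
proof -
  have nz: "\<forall>u\<in>nonzero_vecs N. mass R u \<noteq> 0" using mass_pos[OF _ assms] by force
  note c = continuous_signed_powr[OF p] and l = continuous_signed_powr_ln[OF p]
  show ?thesis unfolding residual_def
    by (intro continuous_on_diff continuous_on_add continuous_on_mult continuous_on_sum continuous_on_const
        continuous_on_divide continuous_energy continuous_mass nz continuous_coord_comp(1)[OF l] continuous_coord_comp[OF c])
qed

lemma continuous_level:
  assumes "N \<le> R"
  shows "continuous_on (nonzero_vecs N) (level R)"
proof -
  have nz: "\<forall>u\<in>nonzero_vecs N. mass R u \<noteq> 0" using mass_pos[OF _ assms] by force
  show ?thesis unfolding level_def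
    by (intro continuous_on_add continuous_on_divide continuous_on_ln continuous_energy continuous_mass nz)
qed

lemma mass_scale: "c > 0 \<Longrightarrow> mass R (\<lambda>i. c * u i) = c powr p * mass R u"
  by (simp add: mass_def abs_mult powr_mult sum_distrib_left)

lemma energy_scale:
  assumes "c > 0"
  shows "energy R (\<lambda>i. c * u i) = c powr p * (energy R u - ln (c powr p) * mass R u)"
proof -
  have "\<bar>c * u x - c * u y\<bar> powr p = c powr p * \<bar>u x - u y\<bar> powr p" for x y
    using assms by (simp add: abs_mult powr_mult flip: right_diff_distrib)
  hence d: "dirichlet R (\<lambda>i. c * u i) = c powr p * dirichlet R u"
    by (simp add: dirichlet_def sum_distrib_left mult_ac)
  have "\<bar>c * u x\<bar> powr p * ln (\<bar>c * u x\<bar> powr p) =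
     c powr p * (\<bar>u x\<bar> powr p * ln (\<bar>u x\<bar> powr p) + ln (c powr p) * \<bar>u x\<bar> powr p)" for x
    using assms p by (cases "u x = 0") (auto simp: abs_mult powr_mult ln_mult algebra_simps)
  hence l: "(\<Sum>x<R. \<bar>c * u x\<bar> powr p * ln (\<bar>c * u x\<bar> powr p)) =
     c powr p * ((\<Sum>x<R. \<bar>u x\<bar> powr p * ln (\<bar>u x\<bar> powr p)) + ln (c powr p) * mass R u)"
    by (simp add: mass_def sum_distrib_left distrib_left sum.distrib)
  have "(\<Sum>x<R. V x * \<bar>c * u x\<bar> powr p) = c powr p * (\<Sum>x<R. V x * \<bar>u x\<bar> powr p)"
    using assms by (simp add: abs_mult powr_mult sum_distrib_left mult_ac)
  thus ?thesis using d l by (simp add: energy_def algebra_simps)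
qed

lemma level_scale:
  assumes "u \<in> nonzero_vecs N" "N \<le> R" "c > 0"
  shows "level R (\<lambda>i. c * u i) = level R u"
  using mass_pos[OF assms(1,2)] assms(3)
  by (simp add: level_def mass_scale energy_scale ln_mult diff_divide_distrib)

lemma dirichlet_nonneg: "dirichlet R u \<ge> 0"
  by (simp add: dirichlet_def sum_nonneg)

text \<open>
Bounded degree makes the Dirichlet energy subordinate to the mass, with a constant that does not depend on the cutoff.
\<close>

lemma dirichlet_le: "dirichlet R u \<le> 2 powr p * C * mass R u"
proof -
  have deg: "(\<Sum>y<R. of_bool (E x y)) \<le> real C" for x
  proof -
    have "(\<Sum>y<R. of_bool (E x y)) = real (card ({..<R} \<inter> {y. E x y}))"
      by (simp add: of_bool_def sum.If_cases)
    also have "\<dots> \<le> real (card {y. E y x})"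
      using finite_nbrs adj_sym by (intro of_nat_mono card_mono) auto
    finally show ?thesis using card_nbrs[of x] by linarith
  qed
  have "(\<Sum>x<R. \<Sum>y<R. of_bool (E x y) * \<bar>u x - u y\<bar> powr p)
     \<le> (\<Sum>x<R. \<Sum>y<R. of_bool (E x y) * (2 powr p * (\<bar>u x\<bar> powr p + \<bar>u y\<bar> powr p)))"
    using p by (intro sum_mono mult_left_mono abs_diff_powr_le) auto
  also have "\<dots> = 2 powr p * ((\<Sum>x<R. \<Sum>y<R. of_bool (E x y) * \<bar>u x\<bar> powr p)
      + (\<Sum>x<R. \<Sum>y<R. of_bool (E x y) * \<bar>u y\<bar> powr p))"
    by (simp add: sum_distrib_left sum.distrib distrib_left mult_ac)
  also have "(\<Sum>x<R. \<Sum>y<R. of_bool (E x y) * \<bar>u y\<bar> powr p) = (\<Sum>x<R. \<Sum>y<R. of_bool (E x y) * \<bar>u x\<bar> powr p)"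
  proof -
    have "E x y = E y x" for x y using adj_sym by blast
    thus ?thesis by (subst sum.swap) simp
  qed
  also have "(\<Sum>x<R. \<Sum>y<R. of_bool (E x y) * \<bar>u x\<bar> powr p) \<le> (\<Sum>x<R. C * \<bar>u x\<bar> powr p)"
    using deg by (intro sum_mono) (simp only: sum_distrib_right[symmetric], intro mult_right_mono, auto)
  also have "\<dots> = C * mass R u" by (simp add: mass_def sum_distrib_left)
  finally show ?thesis by (simp add: dirichlet_def mult_left_mono)
qed

text \<open>
Each summand of the mass is at most the whole mass.
\<close>

lemma entropy_le:
  assumes "mass R u > 0"
  shows "(\<Sum>x<R. \<bar>u x\<bar> powr p * ln (\<bar>u x\<bar> powr p)) \<le> mass R u * ln (mass R u)"
proof -
  have "\<bar>u x\<bar> powr p * ln (\<bar>u x\<bar> powr p) \<le> \<bar>u x\<bar> powr p * ln (mass R u)" if "x < R" for x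
  proof (cases "u x = 0")
    case False
    have "\<bar>u x\<bar> powr p \<le> mass R u" unfolding mass_def using that by (intro member_le_sum) auto
    hence "ln (\<bar>u x\<bar> powr p) \<le> ln (mass R u)" using False assms by (subst ln_le_cancel_iff) auto
    thus ?thesis by (intro mult_left_mono) auto
  qed simp
  hence "(\<Sum>x<R. \<bar>u x\<bar> powr p * ln (\<bar>u x\<bar> powr p)) \<le> (\<Sum>x<R. \<bar>u x\<bar> powr p * ln (mass R u))"
    by (intro sum_mono) auto
  thus ?thesis by (simp add: mass_def sum_distrib_right)
qed

lemma level_lower:
  assumes "u \<in> nonzero_vecs N" "N \<le> R" "\<forall>i<k. u i = 0" "\<And>x. x \<ge> k \<Longrightarrow> a \<le> V x"
  shows "a \<le> level R u"
proof -
  have m: "mass R u > 0" using mass_pos assms by blast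
  have "a * \<bar>u x\<bar> powr p \<le> V x * \<bar>u x\<bar> powr p" for x
    using assms(3,4) by (cases "x < k") (auto intro!: mult_right_mono)
  hence "a * mass R u \<le> (\<Sum>x<R. V x * \<bar>u x\<bar> powr p)"
    unfolding mass_def sum_distrib_left by (intro sum_mono) auto
  hence "a * mass R u - mass R u * ln (mass R u) \<le> energy R u"
    using dirichlet_nonneg[of R u] entropy_le[OF m] by (simp add: energy_def)
  hence "(a * mass R u - mass R u * ln (mass R u)) / mass R u \<le> energy R u / mass R u"
    using m by (intro divide_right_mono) auto
  moreover have "(a * mass R u - mass R u * ln (mass R u)) / mass R u = a - ln (mass R u)"
    using m by (simp add: diff_divide_distrib)
  ultimately show ?thesis by (simp add: level_def)
qed

text \<open>
The three summands bound the contributions of the Dirichlet energy, of the potential, and of the entropy of at most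
\<open>Suc k\<close> points. The value does not depend on the support \<open>N\<close> or the cutoff \<open>R\<close>, which is
what allows the exhaustion of the graph.
\<close>

definition level_bound :: "nat \<Rightarrow> real" where
  "level_bound k = 2 powr p * C + (\<Sum>x\<le>k. \<bar>V x\<bar>) + Suc k"

lemma level_upper:
  assumes "u \<in> nonzero_vecs N" "N \<le> R" "k < R" "\<forall>i>k. u i = 0"
  shows "level R u \<le> level_bound k"
proof -
  define m where "m = mass R u"
  have m: "m > 0" using mass_pos assms unfolding m_def by blast
  have restr: "(\<Sum>x<R. f x) = (\<Sum>x\<le>k. f x)" if "\<And>x. x > k \<Longrightarrow> f x = 0" for f :: "nat \<Rightarrow> real"
    using that \<open>k < R\<close> by (intro sum.mono_neutral_right) auto
  have um: "\<bar>u x\<bar> powr p \<le> m" if "x \<le> k" for x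
    unfolding m_def mass_def using that \<open>k < R\<close> by (intro member_le_sum) auto
  have "(\<Sum>x<R. V x * \<bar>u x\<bar> powr p) = (\<Sum>x\<le>k. V x * \<bar>u x\<bar> powr p)"
    using assms p by (intro restr) auto
  also have "\<dots> \<le> (\<Sum>x\<le>k. \<bar>V x\<bar> * m)"
    using um by (intro sum_mono mult_mono) auto
  finally have v: "(\<Sum>x<R. V x * \<bar>u x\<bar> powr p) \<le> (\<Sum>x\<le>k. \<bar>V x\<bar>) * m"
    by (simp add: sum_distrib_right)
  have "m * ln m - Suc k * m = (\<Sum>x\<le>k. \<bar>u x\<bar> powr p * ln m - m)"
    using restr[of "\<lambda>x. \<bar>u x\<bar> powr p"] assms(4) p
    by (simp add: m_def mass_def sum_subtractf sum_distrib_right)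
  also have "\<dots> \<le> (\<Sum>x\<le>k. \<bar>u x\<bar> powr p * ln (\<bar>u x\<bar> powr p))"
    using m by (intro sum_mono mult_ln_ge) auto
  also have "\<dots> = (\<Sum>x<R. \<bar>u x\<bar> powr p * ln (\<bar>u x\<bar> powr p))"
    using assms p by (intro restr[symmetric]) auto
  finally have "energy R u \<le> 2 powr p * C * m + (\<Sum>x\<le>k. \<bar>V x\<bar>) * m + Suc k * m - m * ln m"
    using v dirichlet_le[of R u] by (simp add: energy_def m_def)
  also have "\<dots> = (level_bound k - ln m) * m"
    by (simp add: level_bound_def algebra_simps)
  finally have "energy R u / m \<le> level_bound k - ln m"
    using m by (subst pos_divide_le_eq)
  thus ?thesis by (simp add: level_def m_def)
qed

text \<open>
The minimax principle gives a critical point \<open>u\<close> of \<open>level\<close>. Multiplication by \<open>c\<close> with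
\<open>ln (c powr p)\<close> equal to the Lagrange multiplier removes the multiplier from the equation, and turns
the level of \<open>u\<close> into the logarithm of the mass of the solution. The last bound holds since the energy of the
rescaled function is zero, so that the potential term is dominated by the entropy term.
\<close>

theorem dirichlet_solution:
  assumes "k < N" "0 \<le> a" "\<And>x. x \<ge> k \<Longrightarrow> a \<le> V x"
  shows "\<exists>v. (\<forall>x\<ge>N. v x = 0) \<and>
     (\<forall>x<N. - p_laplacian E p v x + V x * signed_powr p (v x) = signed_powr p (v x) * ln (\<bar>v x\<bar> powr p)) \<and>
     exp a \<le> (\<Sum>x<N. \<bar>v x\<bar> powr p) \<and> (\<Sum>x<N. \<bar>v x\<bar> powr p) \<le> exp (level_bound k) \<and>
     (\<Sum>x<N. (V x + 1) * \<bar>v x\<bar> powr p) \<le> exp (level_bound k) * (level_bound k + 1)"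
proof -
  have "finite (\<Union>x<N. {y. E y x})" using finite_nbrs by blast
  then obtain R0 where R0: "\<And>y. y \<in> (\<Union>x<N. {y. E y x}) \<Longrightarrow> y < R0"
    using finite_nat_iff_bounded by (metis lessThan_iff subsetD)
  define R where "R = max N R0"
  have R: "N \<le> R" and nb: "\<And>x y. x < N \<Longrightarrow> E y x \<Longrightarrow> y < R" using R0 by (auto simp: R_def less_max_iff_disj)
  define G where "G = (\<lambda>u x. if x < N then p / mass R u * residual R u x else 0)"
  have trunc: "(\<Sum>x<R. w x * g x) = (\<Sum>x<N. w x * g x)" if "\<forall>x\<ge>N. w x = 0" for w g :: "nat \<Rightarrow> real"
    using that R by (intro sum.mono_neutral_right) auto
  have "\<exists>u\<in>nonzero_vecs N. (\<forall>i. G u i = 0) \<and> a \<le> level R u \<and> level R u \<le> level_bound k"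
  proof (rule even_minimax[OF \<open>k < N\<close>])
    show "continuous_on (nonzero_vecs N) (level R)" using R by (rule continuous_level)
    have nz: "\<forall>u\<in>nonzero_vecs N. mass R u \<noteq> 0" using mass_pos[OF _ R] by force
    show "continuous_on (nonzero_vecs N) (\<lambda>u. G u i)" for i
      unfolding G_def by (cases "i < N")
        (auto intro!: continuous_on_mult continuous_on_divide continuous_on_const continuous_mass nz[rule_format]
          continuous_residual[OF R])
    show "G u i = 0" if "N \<le> i" for u i using that by (simp add: G_def)
    show "G (\<lambda>i. - u i) i = - G u i" for u i
    proof -
      have "mass R (\<lambda>i. - u i) = mass R u" by (simp add: mass_def)
      have diff: "- u x - - u y = - (u x - u y)" for x y by simp
      have "energy R (\<lambda>i. - u i) = energy R u"
        unfolding energy_def dirichlet_def diff abs_minus_cancel ..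
      hence "residual R (\<lambda>i. - u i) i = - residual R u i"
        unfolding residual_def diff signed_powr_minus \<open>mass R (\<lambda>i. - u i) = mass R u\<close>
        by (simp add: sum_negf del: minus_diff_eq)
      thus ?thesis using \<open>mass R (\<lambda>i. - u i) = mass R u\<close> by (simp add: G_def)
    qed
    show "level R (\<lambda>i. c * u i) = level R u" if "u \<in> nonzero_vecs N" "c > 0" for u c
      using level_scale that R by blast
    show "((\<lambda>t. level R (\<lambda>i. u i + t * w i)) has_real_derivative (\<Sum>i<N. w i * G (\<lambda>i. u i + t * w i) i)) (at t)"
      if "\<forall>i\<ge>N. w i = 0" "(\<lambda>i. u i + t * w i) \<in> nonzero_vecs N" for u w t
    proof -
      have "(\<Sum>x<R. w x * (p / mass R (\<lambda>i. u i + t * w i) * residual R (\<lambda>i. u i + t * w i) x)) =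
        (\<Sum>i<N. w i * G (\<lambda>i. u i + t * w i) i)"
        unfolding trunc[OF that(1)] G_def by simp
      thus ?thesis using DERIV_level[OF that(2) R] by simp
    qed
    show "a \<le> level R u" if "u \<in> nonzero_vecs N" "\<forall>i<k. u i = 0" for u
      using level_lower that R assms(3) by blast
    show "level R u \<le> level_bound k" if "u \<in> nonzero_vecs N" "\<forall>i>k. u i = 0" for u
      using level_upper that R \<open>k < N\<close> by auto
  qed
  then obtain u where u: "u \<in> nonzero_vecs N" and crit: "\<And>x. G u x = 0" and lo: "a \<le> level R u"
    and hi: "level R u \<le> level_bound k" by blast
  define \<Lambda> where "\<Lambda> = energy R u / mass R u"
  define c where "c = exp (\<Lambda> / p)"
  define v where "v = (\<lambda>i. c * u i)"
  have c: "c > 0" "c powr p = exp \<Lambda>" "ln (c powr p) = \<Lambda>" using p by (auto simp: c_def powr_def)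
  have m: "mass R u > 0" using mass_pos[OF u R] .
  have v0: "\<forall>x\<ge>N. v x = 0" using u by (auto simp: v_def nonzero_vecs_def)
  have "mass R v = exp (level R u)"
    using m by (simp add: v_def mass_scale c level_def exp_add \<Lambda>_def)
  moreover have massN: "mass R v = (\<Sum>x<N. \<bar>v x\<bar> powr p)"
    unfolding mass_def using v0 R p by (intro sum.mono_neutral_right) auto
  ultimately have mv: "(\<Sum>x<N. \<bar>v x\<bar> powr p) = exp (level R u)" by simp
  have eq: "- p_laplacian E p v x + V x * signed_powr p (v x) = signed_powr p (v x) * ln (\<bar>v x\<bar> powr p)"
    if x: "x < N" for x
  proof -
    have "residual R u x = 0" using crit[of x] x m p by (simp add: G_def)
    hence r: "(\<Sum>y<R. of_bool (E x y) * signed_powr p (u x - u y)) + V x * signed_powr p (u x)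
       = signed_powr p (u x) * ln (\<bar>u x\<bar> powr p) + \<Lambda> * signed_powr p (u x)"
      by (simp add: residual_def \<Lambda>_def)
    have "- p_laplacian E p v x = (\<Sum>y | E y x. signed_powr p (v x - v y))"
      unfolding p_laplacian_def sum_negf[symmetric] signed_powr_def[symmetric]
      using signed_powr_minus[of p "v _ - v x"] by simp
    also have "\<dots> = (\<Sum>y<R. of_bool (E x y) * signed_powr p (v x - v y))"
      using nb[OF x] adj_sym by (intro sum.mono_neutral_cong_left) auto
    also have "\<dots> = c powr (p - 1) * (\<Sum>y<R. of_bool (E x y) * signed_powr p (u x - u y))"
      using c by (simp add: v_def signed_powr_mult sum_distrib_left mult_ac flip: right_diff_distrib)
    finally have "- p_laplacian E p v x + V x * signed_powr p (v x) =
       c powr (p - 1) * (signed_powr p (u x) * ln (\<bar>u x\<bar> powr p) + \<Lambda> * signed_powr p (u x))"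
      using c unfolding r[symmetric] by (simp add: v_def signed_powr_mult algebra_simps)
    also have "\<dots> = signed_powr p (v x) * ln (\<bar>v x\<bar> powr p)"
    proof (cases "u x = 0")
      case False
      have "ln (\<bar>v x\<bar> powr p) = \<Lambda> + ln (\<bar>u x\<bar> powr p)"
        using c False by (simp add: v_def abs_mult powr_mult ln_mult)
      thus ?thesis using c by (simp add: v_def signed_powr_mult algebra_simps)
    qed (simp add: v_def)
    finally show ?thesis .
  qed
  have "energy R v = 0"
    using c m by (simp add: v_def energy_scale \<Lambda>_def)
  hence "(\<Sum>x<R. V x * \<bar>v x\<bar> powr p) \<le> (\<Sum>x<R. \<bar>v x\<bar> powr p * ln (\<bar>v x\<bar> powr p))"
    using dirichlet_nonneg[of R v] by (simp add: energy_def)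
  also have "\<dots> \<le> mass R v * ln (mass R v)"
    by (rule entropy_le) (simp add: massN mv)
  also have "\<dots> = exp (level R u) * level R u" by (simp add: massN mv)
  finally have "(\<Sum>x<R. V x * \<bar>v x\<bar> powr p) \<le> exp (level R u) * level R u" .
  moreover have "(\<Sum>x<R. V x * \<bar>v x\<bar> powr p) = (\<Sum>x<N. V x * \<bar>v x\<bar> powr p)"
    using v0 R p by (intro sum.mono_neutral_right) auto
  ultimately have "(\<Sum>x<N. (V x + 1) * \<bar>v x\<bar> powr p) \<le> exp (level R u) * (level R u + 1)"
    using mv by (simp add: distrib_right distrib_left sum.distrib)
  also have "\<dots> \<le> exp (level_bound k) * (level_bound k + 1)"
    using lo hi \<open>0 \<le> a\<close> by (intro mult_mono) auto
  finally show ?thesis using v0 eq mv lo hi by (intro exI[of _ v]) auto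
qed

section \<open>Exhaustion of the graph\<close>

text \<open>
The Dirichlet solutions on \<open>{..<M n}\<close> are bounded in each coordinate, hence converge pointwise along a subsequence, and the
equation passes to the limit because it involves finitely many values at a time. The uniform bound on the weighted mass
prevents loss of mass at infinity: outside a finite set \<open>V\<close> exceeds \<open>D / e\<close>, and there at most mass \<open>e\<close> can lie.
\<close>

theorem unbounded_solutions_on_nat:
  assumes Vpos: "\<And>x. V x > -1" and Vlim: "filterlim V at_top sequentially" and "0 \<le> a"
  shows "\<exists>u. (\<forall>x. - p_laplacian E p u x + V x * signed_powr p (u x) = signed_powr p (u x) * ln (\<bar>u x\<bar> powr p)) \<and>
     summable (\<lambda>x. \<bar>u x\<bar> powr p) \<and> summable (\<lambda>x. (V x + 1) * \<bar>u x\<bar> powr p) \<and>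
     exp a \<le> (\<Sum>x. \<bar>u x\<bar> powr p)"
proof -
  have V1: "0 \<le> V x + 1" for x using Vpos[of x] by simp
  obtain k where k: "\<And>x. x \<ge> k \<Longrightarrow> a \<le> V x"
    using Vlim by (auto simp: filterlim_at_top eventually_sequentially)
  define B where "B = exp (level_bound k)"
  define D where "D = B * (level_bound k + 1)"
  define M where "M = (\<lambda>n. Suc (k + n))"
  define sol where "sol n v \<longleftrightarrow> (\<forall>x\<ge>M n. v x = 0) \<and>
     (\<forall>x<M n. - p_laplacian E p v x + V x * signed_powr p (v x) = signed_powr p (v x) * ln (\<bar>v x\<bar> powr p)) \<and>
     exp a \<le> (\<Sum>x<M n. \<bar>v x\<bar> powr p) \<and> (\<Sum>x<M n. \<bar>v x\<bar> powr p) \<le> B \<and>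
     (\<Sum>x<M n. (V x + 1) * \<bar>v x\<bar> powr p) \<le> D" for n v
  have "\<exists>v. sol n v" for n
    unfolding sol_def B_def D_def using dirichlet_solution[of k "M n" a] k \<open>0 \<le> a\<close> by (simp add: M_def)
  then obtain v where "\<And>n. sol n (v n)" by metis
  hence v0: "M n \<le> x \<Longrightarrow> v n x = 0"
    and eq: "x < M n \<Longrightarrow> - p_laplacian E p (v n) x + V x * signed_powr p (v n x) =
        signed_powr p (v n x) * ln (\<bar>v n x\<bar> powr p)"
    and lo: "exp a \<le> (\<Sum>x<M n. \<bar>v n x\<bar> powr p)" and hi: "(\<Sum>x<M n. \<bar>v n x\<bar> powr p) \<le> B"
    and wt: "(\<Sum>x<M n. (V x + 1) * \<bar>v n x\<bar> powr p) \<le> D" for n x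
    by (auto simp: sol_def)
  have sub: "(\<Sum>x\<in>A. g x * \<bar>v n x\<bar> powr p) \<le> (\<Sum>x<M n. g x * \<bar>v n x\<bar> powr p)"
    if "finite A" "\<And>x. g x \<ge> 0" for A n and g :: "nat \<Rightarrow> real"
  proof -
    have "(\<Sum>x\<in>A. g x * \<bar>v n x\<bar> powr p) = (\<Sum>x\<in>A \<inter> {..<M n}. g x * \<bar>v n x\<bar> powr p)"
      using that(1) v0[of n] p by (intro sum.mono_neutral_right) (auto simp flip: not_le)
    also have "\<dots> \<le> (\<Sum>x<M n. g x * \<bar>v n x\<bar> powr p)" using that by (intro sum_mono2) auto
    finally show ?thesis .
  qed
  have "\<bar>v n x\<bar> \<le> B powr (1 / p)" for n x
  proof -
    have "\<bar>v n x\<bar> powr p \<le> B" using sub[of "{x}" "\<lambda>_. 1" n] hi[of n] by simp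
    hence "(\<bar>v n x\<bar> powr p) powr (1 / p) \<le> B powr (1 / p)" using p by (intro powr_mono2) auto
    thus ?thesis using p by (simp add: powr_powr)
  qed
  then obtain u r where r: "strict_mono r" and "(v \<circ> r) \<longlonglongrightarrow> u"
    using bounded_coordinates_convergent_subseq[of v "\<lambda>_. B powr (1 / p)"] by blast
  hence lim: "(\<lambda>n. v (r n) x) \<longlonglongrightarrow> u x" for x by (simp add: tendsto_fun_iff)
  have comp: "(\<lambda>n. g (w n)) \<longlonglongrightarrow> g l" if "continuous_on UNIV g" "w \<longlonglongrightarrow> l" for g :: "real \<Rightarrow> real" and w l
    using that by (intro continuous_on_tendsto_compose[OF that(1)]) auto
  have sums: "(\<lambda>n. \<Sum>x\<in>A. g x * \<bar>v (r n) x\<bar> powr p) \<longlonglongrightarrow> (\<Sum>x\<in>A. g x * \<bar>u x\<bar> powr p)" for A and g :: "nat \<Rightarrow> real"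
    by (intro tendsto_intros comp[OF continuous_abs_powr] lim)
  have "- p_laplacian E p u x + V x * signed_powr p (u x) = signed_powr p (u x) * ln (\<bar>u x\<bar> powr p)" for x
  proof (rule LIMSEQ_unique)
    show "(\<lambda>n. signed_powr p (v (r n) x) * ln (\<bar>v (r n) x\<bar> powr p)) \<longlonglongrightarrow> signed_powr p (u x) * ln (\<bar>u x\<bar> powr p)"
      by (rule comp[OF continuous_signed_powr_ln[OF p] lim])
    have "(\<lambda>n. - p_laplacian E p (v (r n)) x + V x * signed_powr p (v (r n) x))
        \<longlonglongrightarrow> - p_laplacian E p u x + V x * signed_powr p (u x)"
      unfolding p_laplacian_def signed_powr_def[symmetric]
      by (intro tendsto_intros comp[OF continuous_signed_powr[OF p]] lim)
    moreover have "\<forall>\<^sub>F n in sequentially. - p_laplacian E p (v (r n)) x + V x * signed_powr p (v (r n) x) =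
        signed_powr p (v (r n) x) * ln (\<bar>v (r n) x\<bar> powr p)"
      using eventually_ge_at_top[of x]
    proof eventually_elim
      case (elim n)
      have "n \<le> r n" using r by (rule strict_mono_imp_increasing)
      thus ?case using elim by (intro eq) (simp add: M_def)
    qed
    ultimately show "(\<lambda>n. signed_powr p (v (r n) x) * ln (\<bar>v (r n) x\<bar> powr p))
        \<longlonglongrightarrow> - p_laplacian E p u x + V x * signed_powr p (u x)"
      by (rule Lim_transform_eventually)
  qed
  moreover have sum1: "summable (\<lambda>x. \<bar>u x\<bar> powr p)"
  proof (rule summableI_nonneg_bounded)
    fix K
    have "(\<Sum>x<K. 1 * \<bar>u x\<bar> powr p) \<le> B"
    proof (rule LIMSEQ_le_const2[OF sums], intro exI allI impI)
      fix n show "(\<Sum>x<K. 1 * \<bar>v (r n) x\<bar> powr p) \<le> B"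
        using sub[of "{..<K}" "\<lambda>_. 1" "r n"] hi[of "r n"] by simp
    qed
    thus "(\<Sum>x<K. \<bar>u x\<bar> powr p) \<le> B" by simp
  qed simp
  moreover have "summable (\<lambda>x. (V x + 1) * \<bar>u x\<bar> powr p)"
  proof (rule summableI_nonneg_bounded)
    fix K
    show "(\<Sum>x<K. (V x + 1) * \<bar>u x\<bar> powr p) \<le> D"
    proof (rule LIMSEQ_le_const2[OF sums], intro exI allI impI)
      fix n show "(\<Sum>x<K. (V x + 1) * \<bar>v (r n) x\<bar> powr p) \<le> D"
        using sub[of "{..<K}" "\<lambda>x. V x + 1" "r n"] wt[of "r n"] V1 by auto
    qed
    show "0 \<le> (V K + 1) * \<bar>u K\<bar> powr p" using V1 by simp
  qed
  moreover have "exp a \<le> (\<Sum>x. \<bar>u x\<bar> powr p)"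
  proof (rule field_le_epsilon)
    fix e :: real assume e: "e > 0"
    have D: "D \<ge> 0"
    proof -
      have "0 \<le> (\<Sum>x<M 0. (V x + 1) * \<bar>v 0 x\<bar> powr p)"
        using V1 by (intro sum_nonneg) simp
      thus ?thesis using wt[of 0] by linarith
    qed
    define T where "T = D / e + 1"
    have T: "T > 0" using D e by (simp add: T_def add_nonneg_pos)
    obtain K where K: "\<And>x. x \<ge> K \<Longrightarrow> T \<le> V x"
      using Vlim by (auto simp: filterlim_at_top eventually_sequentially)
    have "exp a - e \<le> (\<Sum>x<K. 1 * \<bar>u x\<bar> powr p)"
    proof (rule LIMSEQ_le_const[OF sums], intro exI allI impI)
      fix n
      let ?w = "v (r n)"
      have "T * (\<Sum>x\<in>{K..<M (r n)}. \<bar>?w x\<bar> powr p) \<le> (\<Sum>x\<in>{K..<M (r n)}. (V x + 1) * \<bar>?w x\<bar> powr p)"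
        unfolding sum_distrib_left using K by (intro sum_mono mult_right_mono) (auto intro: add_increasing2)
      also have "\<dots> \<le> D"
        using sub[of "{K..<M (r n)}" "\<lambda>x. V x + 1" "r n"] wt[of "r n"] V1 by auto
      also have "D \<le> T * e" using e by (simp add: T_def distrib_right)
      finally have tail: "(\<Sum>x\<in>{K..<M (r n)}. \<bar>?w x\<bar> powr p) \<le> e" using T by simp
      have "exp a \<le> (\<Sum>x<M (r n). \<bar>?w x\<bar> powr p)" using lo .
      also have "\<dots> \<le> (\<Sum>x\<in>{..<K} \<union> {K..<M (r n)}. \<bar>?w x\<bar> powr p)"
        by (intro sum_mono2) auto
      also have "\<dots> = (\<Sum>x<K. \<bar>?w x\<bar> powr p) + (\<Sum>x\<in>{K..<M (r n)}. \<bar>?w x\<bar> powr p)"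
        by (intro sum.union_disjoint) auto
      finally show "exp a - e \<le> (\<Sum>x<K. 1 * \<bar>?w x\<bar> powr p)" using tail by simp
    qed
    also have "\<dots> \<le> (\<Sum>x. \<bar>u x\<bar> powr p)" using sum_le_suminf[OF sum1, of "{..<K}"] by simp
    finally show "exp a \<le> (\<Sum>x. \<bar>u x\<bar> powr p) + e" by simp
  qed
  ultimately show ?thesis by blast
qed

end

section \<open>The energy of a pointwise solution\<close>

lemma
  fixes f g :: "'a \<Rightarrow> real"
  assumes "f summable_on A" "g summable_on A"
  shows summable_on_diff: "(\<lambda>x. f x - g x) summable_on A"
    and infsum_diff: "infsum (\<lambda>x. f x - g x) A = infsum f A - infsum g A"
proof -
  have "((\<lambda>x. f x - g x) has_sum (infsum f A - infsum g A)) A"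
    using has_sum_add[OF has_sum_infsum[OF assms(1)] has_sum_uminusI[OF has_sum_infsum[OF assms(2)]]]
    by simp
  thus "(\<lambda>x. f x - g x) summable_on A" "infsum (\<lambda>x. f x - g x) A = infsum f A - infsum g A"
    by (auto simp: summable_on_def infsumI)
qed

lemma nn_integral_count_space_infsum:
  fixes f :: "'a \<Rightarrow> real"
  assumes "f summable_on UNIV" "\<And>x. f x \<ge> 0"
  shows "(\<integral>\<^sup>+x. ennreal (f x) \<partial>count_space UNIV) = ennreal (infsum f UNIV)"
proof -
  have "(\<lambda>x. norm (f x)) summable_on UNIV"
    using assms(1) summable_on_iff_abs_summable_on_real by blast
  note abs = this[unfolded abs_summable_equivalent]
  show ?thesis unfolding nn_integral_conv_infsetsum[OF abs assms(2)] infsetsum_infsum[OF abs] ..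
qed

lemma ext_integral_infsum:
  assumes "f summable_on UNIV"
  shows "ext_integral f = ereal (infsum f UNIV)"
proof -
  have abs: "(\<lambda>x. \<bar>f x\<bar>) summable_on UNIV"
    using assms summable_on_iff_abs_summable_on_real[of f UNIV] by simp
  have pos: "(\<lambda>x. max 0 (f x)) summable_on UNIV" and neg: "(\<lambda>x. max 0 (- f x)) summable_on UNIV"
    by (rule summable_on_comparison_test[OF abs]; auto)+
  have 1: "(\<integral>\<^sup>+x. ennreal (f x) \<partial>count_space UNIV) = ennreal (infsum (\<lambda>x. max 0 (f x)) UNIV)"
    by (subst nn_integral_count_space_infsum[OF pos, symmetric])
      (auto intro!: nn_integral_cong simp: max_def ennreal_neg)
  have 2: "(\<integral>\<^sup>+x. ennreal (- f x) \<partial>count_space UNIV) = ennreal (infsum (\<lambda>x. max 0 (- f x)) UNIV)"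
    by (subst nn_integral_count_space_infsum[OF neg, symmetric])
      (auto intro!: nn_integral_cong simp: max_def ennreal_neg)
  have "infsum f UNIV = infsum (\<lambda>x. max 0 (f x) - max 0 (- f x)) UNIV"
    by (intro infsum_cong) auto
  also have "\<dots> = infsum (\<lambda>x. max 0 (f x)) UNIV - infsum (\<lambda>x. max 0 (- f x)) UNIV"
    by (rule infsum_diff[OF pos neg])
  finally show ?thesis
    unfolding ext_integral_def 1 2 by (simp add: infsum_nonneg)
qed

context bounded_degree_graph
begin

text \<open>
Every edge occurs in both orientations, and \<open>prod.swap\<close> reverses them. Double sums over vertices and
their neighbours are sums over this set, where the order of summation is immaterial.
\<close>

definition arcs :: "('a \<times> 'a) set" where
  "arcs = (SIGMA x:UNIV. {y. E y x})"

lemma bij_swap_arcs: "bij_betw prod.swap arcs arcs"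
  by (rule bij_betwI[of _ _ _ prod.swap]) (auto simp: arcs_def adj_sym)

lemma p_grad_powr: "p_grad E p u x powr p = (1/2) * (\<Sum>y | E y x. \<bar>u y - u x\<bar> powr p)"
  using p by (simp add: p_grad_def powr_powr sum_nonneg)

lemma arcs_summable:
  fixes f :: "'a \<times> 'a \<Rightarrow> real"
  assumes "f summable_on arcs"
  shows "(\<lambda>x. \<Sum>y | E y x. f (x, y)) summable_on UNIV"
    and "infsum (\<lambda>x. \<Sum>y | E y x. f (x, y)) UNIV = infsum f arcs"
proof -
  have eq: "(\<Sum>y | E y x. f (x, y)) = infsum (\<lambda>y. f (x, y)) {y. E y x}" for x
    using finite_nbrs by simp
  show "(\<lambda>x. \<Sum>y | E y x. f (x, y)) summable_on UNIV"
    unfolding eq using assms summable_on_Sigma_banach[of "\<lambda>x y. f (x, y)" UNIV "\<lambda>x. {y. E y x}"]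
    by (simp add: arcs_def)
  show "infsum (\<lambda>x. \<Sum>y | E y x. f (x, y)) UNIV = infsum f arcs"
    unfolding eq using assms infsum_Sigma_banach[of f UNIV "\<lambda>x. {y. E y x}"] by (simp add: arcs_def)
qed

lemma tail_summable_on_arcs:
  fixes g :: "'a \<Rightarrow> real"
  assumes "g summable_on UNIV" "\<And>x. g x \<ge> 0"
  shows "(\<lambda>(x, y). g x) summable_on arcs" "infsum (\<lambda>(x, y). g x) arcs \<le> C * infsum g UNIV"
proof -
  have Cg: "(\<lambda>x. C * g x) summable_on UNIV" using assms(1) by (rule summable_on_cmult_right)
  have le: "real (card {y. E y x}) * g x \<le> C * g x" for x
    using card_nbrs[of x] assms(2) by (intro mult_right_mono) auto
  have "(\<lambda>x. real (card {y. E y x}) * g x) summable_on UNIV"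
    by (rule summable_on_comparison_test[OF Cg le]) (use assms(2) in auto)
  hence "(\<lambda>z. norm (case z of (x, y) \<Rightarrow> g x)) summable_on arcs"
    unfolding arcs_def using finite_nbrs assms(2)
    by (subst Infinite_Sum.abs_summable_on_Sigma_iff) (auto simp: abs_mult)
  thus s: "(\<lambda>(x, y). g x) summable_on arcs" by (rule abs_summable_summable)
  have "infsum (\<lambda>(x, y). g x) arcs = infsum (\<lambda>x. real (card {y. E y x}) * g x) UNIV"
    using arcs_summable(2)[OF s] by simp
  also have "\<dots> \<le> infsum (\<lambda>x. C * g x) UNIV"
    using arcs_summable(1)[OF s] Cg le by (intro infsum_mono) auto
  also have "\<dots> = C * infsum g UNIV" by (rule infsum_cmult_right')
  finally show "infsum (\<lambda>(x, y). g x) arcs \<le> C * infsum g UNIV" .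
qed

lemma head_summable_on_arcs:
  fixes g :: "'a \<Rightarrow> real"
  assumes "g summable_on UNIV" "\<And>x. g x \<ge> 0"
  shows "(\<lambda>(x, y). g y) summable_on arcs" "infsum (\<lambda>(x, y). g y) arcs = infsum (\<lambda>(x, y). g x) arcs"
  using tail_summable_on_arcs(1)[OF assms]
    summable_on_reindex_bij_betw[OF bij_swap_arcs, of "\<lambda>(x, y). g x"]
    infsum_reindex_bij_betw[OF bij_swap_arcs, of "\<lambda>(x, y). g x"]
  by (simp_all add: case_prod_unfold prod.swap_def)

lemma gradient_summable:
  assumes u: "(\<lambda>x. \<bar>u x\<bar> powr p) summable_on UNIV"
  shows "(\<lambda>(x, y). \<bar>u y - u x\<bar> powr p) summable_on arcs"
    and "(\<lambda>x. p_grad E p u x powr p) summable_on UNIV"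
    and "infsum (\<lambda>x. p_grad E p u x powr p) UNIV = (1/2) * infsum (\<lambda>(x, y). \<bar>u y - u x\<bar> powr p) arcs"
    and "infsum (\<lambda>x. p_grad E p u x powr p) UNIV \<le> 2 powr p * C * infsum (\<lambda>x. \<bar>u x\<bar> powr p) UNIV"
proof -
  note t = tail_summable_on_arcs[OF u] and h = head_summable_on_arcs[OF u]
  have "(\<lambda>z. 2 powr p * ((case z of (x, y) \<Rightarrow> \<bar>u y\<bar> powr p) + (case z of (x, y) \<Rightarrow> \<bar>u x\<bar> powr p))) summable_on arcs"
    by (intro summable_on_cmult_right summable_on_add t h) auto
  hence b: "(\<lambda>(x, y). 2 powr p * (\<bar>u y\<bar> powr p + \<bar>u x\<bar> powr p)) summable_on arcs"
    by (simp add: case_prod_unfold)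
  have le: "(case z of (x, y) \<Rightarrow> \<bar>u y - u x\<bar> powr p) \<le> (case z of (x, y) \<Rightarrow> 2 powr p * (\<bar>u y\<bar> powr p + \<bar>u x\<bar> powr p))" for z
    using p abs_diff_powr_le[of p] by (cases z) auto
  show s: "(\<lambda>(x, y). \<bar>u y - u x\<bar> powr p) summable_on arcs"
    by (rule summable_on_comparison_test[OF b le]) auto
  show "(\<lambda>x. p_grad E p u x powr p) summable_on UNIV"
    unfolding p_grad_powr using arcs_summable(1)[OF s] by (intro summable_on_cmult_right) simp
  show eq: "infsum (\<lambda>x. p_grad E p u x powr p) UNIV = (1/2) * infsum (\<lambda>(x, y). \<bar>u y - u x\<bar> powr p) arcs"
    unfolding p_grad_powr infsum_cmult_right' using arcs_summable(2)[OF s] by simp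
  have "infsum (\<lambda>(x, y). \<bar>u y - u x\<bar> powr p) arcs \<le> infsum (\<lambda>(x, y). 2 powr p * (\<bar>u y\<bar> powr p + \<bar>u x\<bar> powr p)) arcs"
    by (rule infsum_mono[OF s b le])
  also have "\<dots> = infsum (\<lambda>z. 2 powr p * ((case z of (x, y) \<Rightarrow> \<bar>u y\<bar> powr p) + (case z of (x, y) \<Rightarrow> \<bar>u x\<bar> powr p))) arcs"
    by (simp add: case_prod_unfold)
  also have "\<dots> = 2 powr p * (infsum (\<lambda>(x, y). \<bar>u y\<bar> powr p) arcs + infsum (\<lambda>(x, y). \<bar>u x\<bar> powr p) arcs)"
    unfolding infsum_cmult_right' by (subst infsum_add[OF h(1) t(1)]) auto
  also have "\<dots> \<le> 2 powr p * (2 * (C * infsum (\<lambda>x. \<bar>u x\<bar> powr p) UNIV))"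
    using t(2) h(2) by (intro mult_left_mono) auto
  finally show "infsum (\<lambda>x. p_grad E p u x powr p) UNIV \<le> 2 powr p * C * infsum (\<lambda>x. \<bar>u x\<bar> powr p) UNIV"
    unfolding eq by simp
qed

text \<open>
The sum over an arc and its reverse of \<open>signed_powr p (u y - u x) * u x\<close> is \<open>- \<bar>u y - u x\<bar> powr p\<close>. Absolute
convergence on \<open>arcs\<close> justifies the regrouping; it follows from the bound of \<open>s powr (p - 1) * t\<close> by the
\<open>p\<close>-th power of the maximum of \<open>s\<close> and \<open>t\<close>.
\<close>

lemma green_identity:
  assumes u: "(\<lambda>x. \<bar>u x\<bar> powr p) summable_on UNIV"
  shows "(\<lambda>x. u x * p_laplacian E p u x) summable_on UNIV"
    and "infsum (\<lambda>x. u x * p_laplacian E p u x) UNIV = - infsum (\<lambda>x. p_grad E p u x powr p) UNIV"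
proof -
  define a where "a = (\<lambda>(x, y). signed_powr p (u y - u x) * u x)"
  have lap: "u x * p_laplacian E p u x = (\<Sum>y | E y x. a (x, y))" for x
    by (simp add: p_laplacian_def a_def signed_powr_def sum_distrib_left mult_ac)
  have "(\<lambda>z. (case z of (x, y) \<Rightarrow> \<bar>u y - u x\<bar> powr p) + (case z of (x, y) \<Rightarrow> \<bar>u x\<bar> powr p)) summable_on arcs"
    by (intro summable_on_add gradient_summable(1)[OF u] tail_summable_on_arcs(1)[OF u]) auto
  hence "(\<lambda>z. \<bar>a z\<bar>) summable_on arcs"
  proof (rule summable_on_comparison_test)
    fix z :: "'a \<times> 'a" obtain x y where z: "z = (x, y)" by (cases z)
    let ?m = "max \<bar>u y - u x\<bar> \<bar>u x\<bar>"
    have "\<bar>a z\<bar> = \<bar>u y - u x\<bar> powr (p - 1) * \<bar>u x\<bar>" by (simp add: a_def z abs_mult abs_signed_powr)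
    also have "\<dots> \<le> ?m powr (p - 1) * ?m"
      using p by (intro mult_mono powr_mono2) auto
    also have "\<dots> = ?m powr p" using p by (simp add: powr_diff max_def)
    also have "\<dots> \<le> \<bar>u y - u x\<bar> powr p + \<bar>u x\<bar> powr p" by (auto simp: max_def)
    finally show "\<bar>a z\<bar> \<le> (case z of (x, y) \<Rightarrow> \<bar>u y - u x\<bar> powr p) + (case z of (x, y) \<Rightarrow> \<bar>u x\<bar> powr p)"
      by (simp add: z)
  qed auto
  hence sa: "a summable_on arcs" using summable_on_iff_abs_summable_on_real[of a arcs] by simp
  show "(\<lambda>x. u x * p_laplacian E p u x) summable_on UNIV"
    unfolding lap by (rule arcs_summable(1)[OF sa])
  have sa': "(\<lambda>z. a (prod.swap z)) summable_on arcs"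
    using sa summable_on_reindex_bij_betw[OF bij_swap_arcs, of a] by simp
  have pair: "a z + a (prod.swap z) = - (case z of (x, y) \<Rightarrow> \<bar>u y - u x\<bar> powr p)" for z
  proof -
    obtain x y where z: "z = (x, y)" by (cases z)
    have "a z + a (prod.swap z) = - (signed_powr p (u y - u x) * (u y - u x))"
      using signed_powr_minus[of p "u y - u x"] by (simp add: z a_def algebra_simps)
    thus ?thesis by (simp add: signed_powr_times_self z)
  qed
  have "2 * infsum a arcs = infsum a arcs + infsum (\<lambda>z. a (prod.swap z)) arcs"
    using infsum_reindex_bij_betw[OF bij_swap_arcs, of a] by simp
  also have "\<dots> = infsum (\<lambda>z. a z + a (prod.swap z)) arcs"
    by (rule infsum_add[OF sa sa', symmetric])
  also have "\<dots> = - infsum (\<lambda>(x, y). \<bar>u y - u x\<bar> powr p) arcs" unfolding pair by (rule infsum_uminus)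
  finally show "infsum (\<lambda>x. u x * p_laplacian E p u x) UNIV = - infsum (\<lambda>x. p_grad E p u x powr p) UNIV"
    unfolding lap arcs_summable(2)[OF sa] gradient_summable(3)[OF u] by simp
qed

text \<open>
By \<open>gradient_summable\<close> the \<open>W1p\<close> norm is equivalent to the \<open>\<ell>\<^sup>p\<close> norm, so restrictions to large finite sets
approximate.
\<close>

lemma summable_in_W1p:
  assumes u: "(\<lambda>x. \<bar>u x\<bar> powr p) summable_on UNIV"
  shows "u \<in> W1p E p"
proof -
  define g where "g = (\<lambda>x. \<bar>u x\<bar> powr p)"
  define K where "K = 2 powr p * C + 1"
  have g: "(g has_sum infsum g UNIV) UNIV" using u by (simp add: g_def)
  have "\<exists>F. finite F \<and> infsum g UNIV - sum g F \<le> 1 / Suc n" for n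
  proof -
    have "\<forall>\<^sub>F F in finite_subsets_at_top UNIV. dist (sum g F) (infsum g UNIV) < 1 / Suc n"
      using g by (intro tendstoD) (auto simp: has_sum_def)
    then obtain F where "finite F" "dist (sum g F) (infsum g UNIV) < 1 / Suc n"
      by (auto simp: eventually_finite_subsets_at_top)
    thus ?thesis by (intro exI[of _ F]) (auto simp: dist_real_def)
  qed
  then obtain F where F: "\<And>n. finite (F n)" "\<And>n. infsum g UNIV - sum g (F n) \<le> 1 / Suc n" by metis
  define f where "f = (\<lambda>n x. if x \<in> F n then u x else 0)"
  have bound: "W1p_norm_pow E p (\<lambda>x. u x - f n x) \<le> ennreal (K * (1 / Suc n))" for n
  proof -
    define w where "w = (\<lambda>x. u x - f n x)"
    have "((\<lambda>x. if x \<in> F n then g x else 0) has_sum sum g (F n)) UNIV"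
      using F(1) by (subst has_sum_cong_neutral[where T = "F n" and g = g]) (auto intro: has_sum_finite)
    from has_sum_add[OF g has_sum_uminusI[OF this]]
    have "((\<lambda>x. \<bar>w x\<bar> powr p) has_sum (infsum g UNIV - sum g (F n))) UNIV"
      by (subst has_sum_cong[where g = "\<lambda>x. g x + - (if x \<in> F n then g x else 0)"]) (auto simp: w_def f_def g_def)
    hence sw: "(\<lambda>x. \<bar>w x\<bar> powr p) summable_on UNIV"
      and iw: "infsum (\<lambda>x. \<bar>w x\<bar> powr p) UNIV \<le> 1 / Suc n"
      using F(2)[of n] by (auto simp: infsumI summable_on_def)
    have "W1p_norm_pow E p w = ennreal (infsum (\<lambda>x. p_grad E p w x powr p + \<bar>w x\<bar> powr p) UNIV)"
      unfolding W1p_norm_pow_def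
      by (intro nn_integral_count_space_infsum summable_on_add gradient_summable(2) sw) auto
    also have "infsum (\<lambda>x. p_grad E p w x powr p + \<bar>w x\<bar> powr p) UNIV =
       infsum (\<lambda>x. p_grad E p w x powr p) UNIV + infsum (\<lambda>x. \<bar>w x\<bar> powr p) UNIV"
      by (intro infsum_add gradient_summable(2) sw)
    also have "\<dots> \<le> K * infsum (\<lambda>x. \<bar>w x\<bar> powr p) UNIV"
      using gradient_summable(4)[OF sw] by (simp add: K_def distrib_right)
    also have "\<dots> \<le> K * (1 / Suc n)"
      using iw by (intro mult_left_mono) (auto simp: K_def)
    finally show ?thesis by (simp add: w_def ennreal_leI)
  qed
  have "(\<lambda>n. K * (1 / real (Suc n))) \<longlonglongrightarrow> K * 0"
    by (intro tendsto_intros lim_1_over_n[THEN LIMSEQ_Suc])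
  hence "(\<lambda>n. ennreal (K * (1 / real (Suc n)))) \<longlonglongrightarrow> ennreal (K * 0)" by (rule tendsto_ennrealI)
  hence lim: "(\<lambda>n. ennreal (K * (1 / real (Suc n)))) \<longlonglongrightarrow> 0" by simp
  have "(\<lambda>n. W1p_norm_pow E p (\<lambda>x. u x - f n x)) \<longlonglongrightarrow> 0"
    by (rule tendsto_sandwich[OF _ _ tendsto_const lim]) (use bound in auto)
  moreover have "finite {x. f n x \<noteq> 0}" for n
    by (rule finite_subset[OF _ F(1)[of n]]) (auto simp: f_def)
  ultimately show ?thesis unfolding W1p_def by blast
qed

text \<open>
Multiplying the equation by \<open>u x\<close> expresses the logarithmic term by summable ones. This gives finiteness of the
energy, and with the Green identity all terms of \<open>J\<close> cancel except for the sum of \<open>\<bar>u x\<bar> powr p\<close>.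
\<close>

theorem pointwise_solution:
  assumes Vpos: "\<And>x. V x > -1"
    and u: "(\<lambda>x. \<bar>u x\<bar> powr p) summable_on UNIV"
    and Vu: "(\<lambda>x. (V x + 1) * \<bar>u x\<bar> powr p) summable_on UNIV"
    and eq: "\<And>x. - p_laplacian E p u x + V x * signed_powr p (u x) = signed_powr p (u x) * ln (\<bar>u x\<bar> powr p)"
  shows "is_solution E p V u" and "J E p V u = ereal (infsum (\<lambda>x. \<bar>u x\<bar> powr p) UNIV / p)"
proof -
  have V1: "0 \<le> V x + 1" for x using Vpos[of x] by simp
  let ?L = "\<lambda>x. \<bar>u x\<bar> powr p * ln (\<bar>u x\<bar> powr p)"
  define S where "S = infsum (\<lambda>x. \<bar>u x\<bar> powr p) UNIV"
  define S_V where "S_V = infsum (\<lambda>x. (V x + 1) * \<bar>u x\<bar> powr p) UNIV"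
  define S_G where "S_G = infsum (\<lambda>x. p_grad E p u x powr p) UNIV"
  have "infsum (\<lambda>x. p_grad E p u x powr p + (V x + 1) * \<bar>u x\<bar> powr p) UNIV = S_G + S_V"
    unfolding S_G_def S_V_def by (intro infsum_add gradient_summable(2) u Vu)
  moreover have "X_energy E p V u = ennreal (infsum (\<lambda>x. p_grad E p u x powr p + (V x + 1) * \<bar>u x\<bar> powr p) UNIV)"
    unfolding X_energy_def
  proof (intro nn_integral_count_space_infsum summable_on_add gradient_summable(2) u Vu)
    fix x show "0 \<le> p_grad E p u x powr p + (V x + 1) * \<bar>u x\<bar> powr p"
      using V1[of x] by simp
  qed
  ultimately have X: "X_energy E p V u = ennreal (S_G + S_V)" by simp
  have nonneg: "S_G + S_V \<ge> 0"
    unfolding S_G_def S_V_def using V1 by (intro add_nonneg_nonneg infsum_nonneg) auto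
  have L: "?L x = ((V x + 1) * \<bar>u x\<bar> powr p - \<bar>u x\<bar> powr p) - u x * p_laplacian E p u x" for x
  proof -
    have "?L x = (signed_powr p (u x) * ln (\<bar>u x\<bar> powr p)) * u x"
      by (simp flip: signed_powr_times_self)
    also have "\<dots> = V x * (signed_powr p (u x) * u x) - u x * p_laplacian E p u x"
      unfolding eq[symmetric] by (simp add: algebra_simps)
    finally show ?thesis unfolding signed_powr_times_self by (simp add: algebra_simps)
  qed
  note sums = summable_on_diff[OF summable_on_diff[OF Vu u] green_identity(1)[OF u]]
  have "?L summable_on UNIV" unfolding L by (rule sums)
  hence "ext_integral ?L = ereal (infsum ?L UNIV)" by (rule ext_integral_infsum)
  also have "infsum ?L UNIV = S_V - S + S_G"
    unfolding L infsum_diff[OF summable_on_diff[OF Vu u] green_identity(1)[OF u]]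
      infsum_diff[OF Vu u] green_identity(2)[OF u] S_def S_V_def S_G_def by simp
  finally have "J E p V u = ereal (1 / p * (S_G + S_V) - 1 / p * (S_V - S + S_G))"
    unfolding J_def X using nonneg by simp
  also have "1 / p * (S_G + S_V) - 1 / p * (S_V - S + S_G) = S / p" by (simp add: add_divide_distrib diff_divide_distrib)
  finally show J: "J E p V u = ereal (infsum (\<lambda>x. \<bar>u x\<bar> powr p) UNIV / p)" by (simp add: S_def)
  have "u \<in> X_space E p V" using summable_in_W1p[OF u] X by (simp add: X_space_def)
  thus "is_solution E p V u" using J eq by (simp add: is_solution_def signed_powr_def)
qed

end

section \<open>Infinitely many solutions\<close>

lemma finite_walks_to:
  fixes E :: "'a \<Rightarrow> 'a \<Rightarrow> bool"
  assumes "\<And>x. finite {y. E y x}"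
  shows "finite {x. (E ^^ n) x x0}"
proof (induction n)
  case (Suc n)
  have "{x. (E ^^ Suc n) x x0} \<subseteq> (\<Union>z\<in>{x. (E ^^ n) x x0}. {x. E x z})"
  proof
    fix x assume "x \<in> {x. (E ^^ Suc n) x x0}"
    then obtain z where "E x z" "(E ^^ n) z x0" by (auto dest: relpowp_Suc_D2 simp del: relpowp.simps)
    thus "x \<in> (\<Union>z\<in>{x. (E ^^ n) x x0}. {x. E x z})" by blast
  qed
  thus ?case using Suc assms by (meson finite_UN_I finite_subset)
qed simp

theorem theorem6p1:
  fixes E :: "'a \<Rightarrow> 'a \<Rightarrow> bool" and p :: real and V :: "'a \<Rightarrow> real"
  assumes "p > 1"
    and "infinite (UNIV :: 'a set)"
    and "symp E" and "irreflp E"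
    and "graph_connected E"
    and "uniformly_locally_finite E"
    and "(INF x. ereal (V x)) > -1"
    and "\<exists>x0. filterlim V at_top (filtercomap (\<lambda>x. graph_dist E x x0) at_top)"
  shows "\<exists>u :: nat \<Rightarrow> 'a \<Rightarrow> real.
           (\<forall>n. is_solution E p V (u n) \<and> is_solution E p V (\<lambda>x. - u n x)) \<and>
           (\<forall>m n. m \<noteq> n \<longrightarrow> u m \<noteq> u n \<and> u m \<noteq> (\<lambda>x. - u n x)) \<and>
           (\<lambda>n. J E p V (u n)) \<longlonglongrightarrow> \<infinity> \<and>
           (\<lambda>n. J E p V (\<lambda>x. - u n x)) \<longlonglongrightarrow> \<infinity>"
proof -
  obtain C where C: "\<And>x. finite {y. E y x}" "\<And>x. card {y. E y x} \<le> C"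
    using \<open>uniformly_locally_finite E\<close> by (auto simp: uniformly_locally_finite_def)
  have sym: "E x y \<Longrightarrow> E y x" for x y using \<open>symp E\<close> by (rule sympD)
  interpret bounded_degree_graph E p C
    by unfold_locales (use C sym \<open>p > 1\<close> in auto)
  have Vpos: "V x > -1" for x
  proof -
    have "ereal (-1) < ereal (V x)"
      using \<open>(INF x. ereal (V x)) > -1\<close> INF_lower[of x UNIV "\<lambda>x. ereal (V x)"]
      by (metis UNIV_I less_le_trans one_ereal_def uminus_ereal.simps(1))
    thus ?thesis by simp
  qed
  obtain x0 where x0: "filterlim V at_top (filtercomap (\<lambda>x. graph_dist E x x0) at_top)"
    using assms(8) by blast
  have walk: "\<exists>n. (E ^^ n) x x0" for x
    using \<open>graph_connected E\<close> by (simp add: graph_connected_def rtranclp_power)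
  note finite_walks = finite_walks_to[of E _ x0, OF C(1)]
  have "(UNIV :: 'a set) = (\<Union>n. {x. (E ^^ n) x x0})" using walk by auto
  moreover have "countable (\<Union>n. {x. (E ^^ n) x x0})"
    using finite_walks by (intro countable_UN) (auto intro: countable_finite)
  ultimately have "countable (UNIV :: 'a set)" by simp
  then obtain f :: "'a \<Rightarrow> nat" where f: "bij f"
    using \<open>infinite UNIV\<close> by (metis countableE_infinite)
  define g where "g = inv f"
  have g: "bij g" and gf: "\<And>x. g (f x) = x" and fg: "\<And>n. f (g n) = n"
    using f by (auto simp: g_def bij_imp_bij_inv bij_is_inj bij_is_surj surj_f_inv_f)
  have img: "{m. E (g m) x} = f ` {y. E y x}" for x
  proof (intro equalityI subsetI)
    fix m assume "m \<in> {m. E (g m) x}"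
    thus "m \<in> f ` {y. E y x}" using fg[of m] by (intro image_eqI[of _ _ "g m"]) auto
  qed (auto simp: gf)
  have injf: "inj_on f A" for A using f by (meson bij_is_inj inj_on_subset subset_UNIV)
  interpret N: log_graph "\<lambda>m n. E (g m) (g n)" p C "V \<circ> g"
  proof
    fix x show "finite {y. E (g y) (g x)}" unfolding img using C by blast
    show "card {y. E (g y) (g x)} \<le> C" unfolding img using C(2) by (simp add: card_image[OF injf])
  qed (use sym \<open>p > 1\<close> in auto)
  \<comment> \<open>Balls are finite, so \<open>V\<close> is large outside finite sets, and hence along any enumeration of the vertices.\<close>
  have Vlim: "filterlim (V \<circ> g) at_top sequentially"
    unfolding filterlim_at_top
  proof
    fix c
    obtain R where R: "\<And>x. graph_dist E x x0 \<ge> R \<Longrightarrow> V x \<ge> c"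
      using x0 unfolding filterlim_at_top eventually_filtercomap eventually_at_top_linorder by meson
    have "{x. V x < c} \<subseteq> (\<Union>n<R. {x. (E ^^ n) x x0})"
    proof
      fix x assume "x \<in> {x. V x < c}"
      hence "graph_dist E x x0 < R" using R[of x] by (auto simp: not_le[symmetric])
      moreover have "(E ^^ graph_dist E x x0) x x0"
        unfolding graph_dist_def using walk[of x] by (rule LeastI_ex)
      ultimately show "x \<in> (\<Union>n<R. {x. (E ^^ n) x x0})" by blast
    qed
    hence "finite {x. V x < c}" using finite_walks by (meson finite_UN_I finite_lessThan finite_subset)
    hence "finite (f ` {x. V x < c})" by simp
    moreover have "{n. \<not> c \<le> (V \<circ> g) n} \<subseteq> f ` {x. V x < c}"
    proof
      fix n assume "n \<in> {n. \<not> c \<le> (V \<circ> g) n}"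
      thus "n \<in> f ` {x. V x < c}" using fg[of n] by (intro image_eqI[of _ _ "g n"]) auto
    qed
    ultimately have "finite {n. \<not> c \<le> (V \<circ> g) n}" by (rule finite_subset[rotated])
    thus "\<forall>\<^sub>F n in sequentially. c \<le> (V \<circ> g) n"
      unfolding cofinite_eq_sequentially[symmetric] eventually_cofinite .
  qed
  define good where "good u c \<longleftrightarrow> is_solution E p V u \<and> is_solution E p V (\<lambda>x. - u x) \<and>
      J E p V u = ereal c \<and> J E p V (\<lambda>x. - u x) = ereal c" for u c
  have large: "\<exists>u c. good u c \<and> b < c" for b :: real
  proof -
    define a where "a = p * \<bar>b\<bar>"
    obtain w where eq: "\<And>n. - p_laplacian (\<lambda>m n. E (g m) (g n)) p w n + (V \<circ> g) n * signed_powr p (w n) =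
        signed_powr p (w n) * ln (\<bar>w n\<bar> powr p)"
      and w: "summable (\<lambda>n. \<bar>w n\<bar> powr p)" and Vw: "summable (\<lambda>n. ((V \<circ> g) n + 1) * \<bar>w n\<bar> powr p)"
      and lo: "exp a \<le> (\<Sum>n. \<bar>w n\<bar> powr p)"
      using N.unbounded_solutions_on_nat[of a] Vpos Vlim \<open>p > 1\<close> by (auto simp: a_def)
    define u where "u = (\<lambda>x. w (f x))"
    have V1: "0 \<le> V x + 1" for x using Vpos[of x] by simp
    have "((\<lambda>n. \<bar>w n\<bar> powr p) has_sum (\<Sum>n. \<bar>w n\<bar> powr p)) UNIV"
      using w by (intro sums_nonneg_imp_has_sum summable_sums) auto
    hence hs: "((\<lambda>x. \<bar>u x\<bar> powr p) has_sum (\<Sum>n. \<bar>w n\<bar> powr p)) UNIV"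
      unfolding u_def using has_sum_reindex_bij_betw[OF f, of "\<lambda>n. \<bar>w n\<bar> powr p"] by simp
    have "((\<lambda>n. (V (g n) + 1) * \<bar>w n\<bar> powr p) has_sum (\<Sum>n. (V (g n) + 1) * \<bar>w n\<bar> powr p)) UNIV"
      using Vw V1 by (intro sums_nonneg_imp_has_sum summable_sums) auto
    hence "((\<lambda>x. (V x + 1) * \<bar>u x\<bar> powr p) has_sum (\<Sum>n. (V (g n) + 1) * \<bar>w n\<bar> powr p)) UNIV"
      unfolding u_def using has_sum_reindex_bij_betw[OF f, of "\<lambda>n. (V (g n) + 1) * \<bar>w n\<bar> powr p"]
      by (simp add: gf)
    hence Vu: "(\<lambda>x. (V x + 1) * \<bar>u x\<bar> powr p) summable_on UNIV" by (auto simp: summable_on_def)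
    have su: "(\<lambda>x. \<bar>u x\<bar> powr p) summable_on UNIV" using hs by (auto simp: summable_on_def)
    have equ: "- p_laplacian E p u x + V x * signed_powr p (u x) = signed_powr p (u x) * ln (\<bar>u x\<bar> powr p)" for x
    proof -
      have "p_laplacian (\<lambda>m n. E (g m) (g n)) p w (f x) = p_laplacian E p u x"
        unfolding p_laplacian_def gf img u_def by (simp add: sum.reindex[OF injf])
      thus ?thesis using eq[of "f x"] by (simp add: gf u_def)
    qed
    have neg: "- p_laplacian E p (\<lambda>x. - u x) x + V x * signed_powr p (- u x) =
        signed_powr p (- u x) * ln (\<bar>- u x\<bar> powr p)" for x
    proof -
      have "- u y - - u x = - (u y - u x)" for y by simp
      hence "p_laplacian E p (\<lambda>x. - u x) x = - p_laplacian E p u x"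
        unfolding p_laplacian_def signed_powr_def[symmetric]
        by (simp only: signed_powr_minus sum_negf)
      thus ?thesis using equ[of x] by (simp add: signed_powr_minus)
    qed
    have "good u ((\<Sum>n. \<bar>w n\<bar> powr p) / p)"
      using pointwise_solution[OF Vpos su Vu equ] pointwise_solution[of V "\<lambda>x. - u x"] Vpos su Vu neg
        infsumI[OF hs] by (simp add: good_def)
    moreover have "b < (\<Sum>n. \<bar>w n\<bar> powr p) / p"
    proof -
      have "p * b \<le> a" using \<open>p > 1\<close> by (simp add: a_def)
      also have "a < exp a" using exp_ge_add_one_self[of a] by linarith
      finally show ?thesis using lo \<open>p > 1\<close> by (simp add: pos_less_divide_eq mult.commute)
    qed
    ultimately show ?thesis by blast
  qed
  \<comment> \<open>Strictly increasing energies distinguish the solutions also up to sign, since \<open>J\<close> is even.\<close>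
  obtain h where h: "\<And>n. good (fst (h n)) (snd (h n))" "\<And>n. max (snd (h n)) (real (Suc n)) < snd (h (Suc n))"
  proof -
    have "\<exists>h. \<forall>n. good (fst (h n)) (snd (h n)) \<and> max (snd (h n)) (real (Suc n)) < snd (h (Suc n))"
    proof (rule dependent_nat_choice)
      show "\<exists>z. good (fst z) (snd z)" using large[of 0] by auto
      show "\<exists>z'. good (fst z') (snd z') \<and> max (snd z) (real (Suc n)) < snd z'" for z n
        using large[of "max (snd z) (real (Suc n))"] by auto
    qed
    thus ?thesis using that by blast
  qed
  define u where "u = (\<lambda>n. fst (h n))"
  define c where "c = (\<lambda>n. snd (h n))"
  have good: "good (u n) (c n)" for n using h by (simp add: u_def c_def)
  have mono: "strict_mono c"
    unfolding strict_mono_Suc_iff using h(2) by (auto simp: c_def)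
  have "filterlim c at_top sequentially"
  proof (rule filterlim_at_top_mono[OF filterlim_real_sequentially])
    show "\<forall>\<^sub>F n in sequentially. real n \<le> c n"
      using eventually_gt_at_top[of 0]
    proof eventually_elim
      case (elim n)
      then obtain n' where "n = Suc n'" by (cases n) auto
      thus ?case using h(2)[of n'] by (simp add: c_def)
    qed
  qed
  hence "(\<lambda>n. ereal (c n)) \<longlonglongrightarrow> \<infinity>" by (simp add: tendsto_PInfty_eq_at_top)
  moreover have "u m \<noteq> u n \<and> u m \<noteq> (\<lambda>x. - u n x)" if "m \<noteq> n" for m n
  proof -
    have "c m \<noteq> c n" using mono that by (simp add: strict_mono_eq)
    thus ?thesis using good[of m] good[of n] by (auto simp: good_def)
  qed
  ultimately show ?thesis
    using good by (intro exI[of _ u]) (simp add: good_def)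
qed

end
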